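(* Let $(G,\Lambda)$ be a countable pseudo-free self-similar row-finite $k$-graph without sources. Then the Exel–Pardo groupoid $\mathcal G:=\mathcal G_{G,\Lambda}$, with its standard grading $\Phi\colon\mathcal G\to\mathbb Z^k$, has essentially central isotropy if and only if the following condition is satisfied: for all $M\in\mathcal M(G,\Lambda)$ and $v\in M$, there are no $g\ne1_G$ that act trivially on $v\Lambda M$.
   Context: $k$-graphs. $\mathbb Z_+=\{0,1,\dots\}$. A $k$-graph is a small category $\Lambda$ (identified with its set of morphisms) with a functor $d\colon\Lambda\to\mathbb Z_+^k$ such that whenever $d(\mu)=n+m$ there are unique $\alpha,\beta$ with $d(\alpha)=n$, $d(\beta)=m$, $\mu=\alpha\beta$. $\Lambda^n=d^{-1}(n)$; $\Lambda^0$ is identified with the set of objects (vertices); $r,s$ are codomain and domain maps. For subsets $A,B\subset\Lambda$, $AB=\{\alpha\beta:\alpha\in A,\beta\in B,s(\alpha)=r(\beta)\}$, e.g. $v\Lambda M=\{\lambda\in\Lambda:r(\lambda)=v,s(\lambda)\in M\}$. Row-finite without sources: $0<|v\Lambda^n|<\infty$ for all $v\in\Lambda^0$, $n\in\mathbb Z_+^k$. $\Lambda^\infty$ is the set of infinite paths, i.e. degree-preserving functors $x$ from the $k$-graph $\{(p,q)\in\mathbb Z_+^k\times\mathbb Z_+^k:p\le q\}$ ($r(p,q)=p$, $s(p,q)=q$, $d(p,q)=q-p$) to $\Lambda$; $x(n)=x(n,n)$, $r(x)=x(0)$, $\sigma^n(x)(p,q)=x(n+p,n+q)$, $\lambda x$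 is concatenation. The sets $\lambda\Lambda^\infty$ form a basis of the topology on $\Lambda^\infty$; for such $\Lambda$ the boundary path space $\partial\Lambda$ equals $\Lambda^\infty$. Self-similarity. $(G,\Lambda)$ is a self-similar $k$-graph if the discrete group $G$ acts on the set $\Lambda$ preserving $d$ and commuting with $r,s$, and we are given $G\times\Lambda\to G$, $(g,\mu)\mapsto g|_\mu$, with: $g\cdot(\mu\nu)=(g\cdot\mu)(g|_\mu\cdot\nu)$ and $g|_{\mu\nu}=(g|_\mu)|_\nu$ when $s(\mu)=r(\nu)$; $(gh)|_\mu=g|_{h\cdot\mu}h|_\mu$; $g|_v=g$ for $v\in\Lambda^0$. Pseudo-free: $g\cdot\mu=\mu$ and $g|_\mu=1_G$ imply $g=1_G$. Countable: $G$ and $\Lambda$ are countable. $G$ acts on $\Lambda^\infty$ by $(g\cdot x)(n,m)=g|_{x(0,n)}\cdot x(n,m)$. Groupoid. $Q_k(G)$ is the group of maps $\mathbb Z_+^k\to G$ modulo equality at all $n\ge m$ for some $m$; $\mathcal T_m$ ($m\in\mathbb Z^k$) is the automorphism of $Q_k(G)$ induced by $\mathcal T_m(f)(n)=f(n-m)$ if $n\ge m$, $1_G$ otherwise; $[g|_x]$ is the class of $n\mapsto g|_{x(0,n)}$. $\mathcal G_{G,\Lambda}$ is the set of quadruples $(\mu(g\cdot x),\mathcal T_{d(\mu)}([g|_x]),d(\mu)-d(\nu),\nu x)$, $x\in\Lambda^\infty$, $g\in G$, $\mu,\nu\in\Lambda$, $s(\nu)=r(x)$, $s(\mu)=g\cdot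 r(x)$, with product $(x,q,m,y)(y,q',n,z)=(x,q\mathcal T_m(q'),m+n,z)$, unit space $\Lambda^\infty$, and basis of topology given by the sets of such quadruples with $\mu,g,\nu$ fixed and $x\in s(\nu)\Lambda^\infty$ arbitrary. In the pseudo-free case it is a Hausdorff locally compact étale groupoid. $\Phi(y,q,n,z)=n$. Essentially central isotropy: for every unit $x$ with orbit $[x]$, $\Phi$ is injective on the fiber $\operatorname{Iso}(\mathcal G_{\overline{[x]}})^\circ_x$ of the interior, relative to the reduced groupoid $\mathcal G_{\overline{[x]}}=\{g:r(g)\in\overline{[x]}\}$, of its isotropy bundle, and the image is in the center of the grading group (automatic for $\mathbb Z^k$). Tails. $v\ge w$ means $v\Lambda w\ne\emptyset$. A maximal $G$-tail is a nonempty $G$-invariant $M\subset\Lambda^0$ such that: if $v\ge w$ and $w\in M$ then $v\in M$; if $v\in M$ then $v\Lambda^{e_i}M\ne\emptyset$ for all $1\le i\le k$ ($e_i$ the standard generators of $\mathbb Z_+^k$); for all $v,w\in M$ there are $g\in G$, $u\in M$ with $v\ge u$, $w\ge g\cdot u$. $\mathcal M(G,\Lambda)$ is the set of maximal $G$-tails. *)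

theory Defs
  imports
    "HOL-Analysis.Analysis"
    "HOL-Algebra.Group_Action"
    "HOL-Library.Function_Algebras"
    "HOL-Library.Countable_Set"
begin

section \<open>Higher-rank graphs\<close>

text \<open>
  The monoid of degrees is \<open>'k \<Rightarrow> nat\<close> for a finite index type \<open>'k\<close> with \<open>k\<close> elements,
  with pointwise addition, subtraction and order.  A small category is given by its morphisms
  alone: an object is identified with its identity morphism, so \<open>rng\<close> and \<open>src\<close> (codomain and
  domain) take values in morphisms.  \<open>cmp \<Lambda> \<mu> \<nu>\<close> is only meaningful if \<open>src \<Lambda> \<mu> = rng \<Lambda> \<nu>\<close>.
\<close>

record ('l, 'k) kgraph =
  Mor :: "'l set"
  rng :: "'l \<Rightarrow> 'l"
  src :: "'l \<Rightarrow> 'l"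
  cmp :: "'l \<Rightarrow> 'l \<Rightarrow> 'l"
  deg :: "'l \<Rightarrow> 'k \<Rightarrow> nat"

locale k_graph =
  fixes \<Lambda> :: "('l, 'k::finite) kgraph"
  assumes rng_closed: "\<mu> \<in> Mor \<Lambda> \<Longrightarrow> rng \<Lambda> \<mu> \<in> Mor \<Lambda>"
    and src_closed: "\<mu> \<in> Mor \<Lambda> \<Longrightarrow> src \<Lambda> \<mu> \<in> Mor \<Lambda>"
    and rng_src: "\<mu> \<in> Mor \<Lambda> \<Longrightarrow> rng \<Lambda> (src \<Lambda> \<mu>) = src \<Lambda> \<mu>"
    and src_rng: "\<mu> \<in> Mor \<Lambda> \<Longrightarrow> src \<Lambda> (rng \<Lambda> \<mu>) = rng \<Lambda> \<mu>"
    and cmp_closed: "\<lbrakk>\<mu> \<in> Mor \<Lambda>; \<nu> \<in> Mor \<Lambda>; src \<Lambda> \<mu> = rng \<Lambda> \<nu>\<rbrakk> \<Longrightarrow> cmp \<Lambda> \<mu> \<nu> \<in> Mor \<Lambda>"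
    and rng_cmp: "\<lbrakk>\<mu> \<in> Mor \<Lambda>; \<nu> \<in> Mor \<Lambda>; src \<Lambda> \<mu> = rng \<Lambda> \<nu>\<rbrakk> \<Longrightarrow> rng \<Lambda> (cmp \<Lambda> \<mu> \<nu>) = rng \<Lambda> \<mu>"
    and src_cmp: "\<lbrakk>\<mu> \<in> Mor \<Lambda>; \<nu> \<in> Mor \<Lambda>; src \<Lambda> \<mu> = rng \<Lambda> \<nu>\<rbrakk> \<Longrightarrow> src \<Lambda> (cmp \<Lambda> \<mu> \<nu>) = src \<Lambda> \<nu>"
    and cmp_assoc: "\<lbrakk>\<kappa> \<in> Mor \<Lambda>; \<mu> \<in> Mor \<Lambda>; \<nu> \<in> Mor \<Lambda>; src \<Lambda> \<kappa> = rng \<Lambda> \<mu>; src \<Lambda> \<mu> = rng \<Lambda> \<nu>\<rbrakk>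
      \<Longrightarrow> cmp \<Lambda> (cmp \<Lambda> \<kappa> \<mu>) \<nu> = cmp \<Lambda> \<kappa> (cmp \<Lambda> \<mu> \<nu>)"
    and cmp_rng: "\<mu> \<in> Mor \<Lambda> \<Longrightarrow> cmp \<Lambda> (rng \<Lambda> \<mu>) \<mu> = \<mu>"
    and cmp_src: "\<mu> \<in> Mor \<Lambda> \<Longrightarrow> cmp \<Lambda> \<mu> (src \<Lambda> \<mu>) = \<mu>"
    and deg_rng: "\<mu> \<in> Mor \<Lambda> \<Longrightarrow> deg \<Lambda> (rng \<Lambda> \<mu>) = 0"
    and deg_src: "\<mu> \<in> Mor \<Lambda> \<Longrightarrow> deg \<Lambda> (src \<Lambda> \<mu>) = 0"
    and deg_cmp: "\<lbrakk>\<mu> \<in> Mor \<Lambda>; \<nu> \<in> Mor \<Lambda>; src \<Lambda> \<mu> = rng \<Lambda> \<nu>\<rbrakk>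
      \<Longrightarrow> deg \<Lambda> (cmp \<Lambda> \<mu> \<nu>) = deg \<Lambda> \<mu> + deg \<Lambda> \<nu>"
    and factorization: "\<lbrakk>\<mu> \<in> Mor \<Lambda>; deg \<Lambda> \<mu> = n + m\<rbrakk>
      \<Longrightarrow> \<exists>!p. fst p \<in> Mor \<Lambda> \<and> snd p \<in> Mor \<Lambda> \<and> src \<Lambda> (fst p) = rng \<Lambda> (snd p) \<and>
              deg \<Lambda> (fst p) = n \<and> deg \<Lambda> (snd p) = m \<and> \<mu> = cmp \<Lambda> (fst p) (snd p)"

definition vertices :: "('l, 'k) kgraph \<Rightarrow> 'l set" where
  "vertices \<Lambda> = {v \<in> Mor \<Lambda>. deg \<Lambda> v = 0}"

text \<open>\<open>paths_into \<Lambda> v M\<close> is \<open>v\<Lambda>M\<close>.\<close>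

definition paths_into :: "('l, 'k) kgraph \<Rightarrow> 'l \<Rightarrow> 'l set \<Rightarrow> 'l set" where
  "paths_into \<Lambda> v M = {\<mu> \<in> Mor \<Lambda>. rng \<Lambda> \<mu> = v \<and> src \<Lambda> \<mu> \<in> M}"

definition row_finite_without_sources :: "('l, 'k) kgraph \<Rightarrow> bool" where
  "row_finite_without_sources \<Lambda> \<longleftrightarrow>
    (\<forall>v \<in> vertices \<Lambda>. \<forall>n.
      finite {\<mu> \<in> Mor \<Lambda>. rng \<Lambda> \<mu> = v \<and> deg \<Lambda> \<mu> = n} \<and>
      {\<mu> \<in> Mor \<Lambda>. rng \<Lambda> \<mu> = v \<and> deg \<Lambda> \<mu> = n} \<noteq> {})"


section \<open>Infinite paths\<close>

text \<open>
  A functor from \<open>{(p, q). p \<le> q}\<close> is represented by a function of \<open>p\<close> and \<open>q\<close> that is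
  \<open>undefined\<close> unless \<open>p \<le> q\<close>, so that equality of functions is equality of functors.
\<close>

type_synonym ('l, 'k) ipath = "('k \<Rightarrow> nat) \<Rightarrow> ('k \<Rightarrow> nat) \<Rightarrow> 'l"

definition infinite_paths :: "('l, 'k) kgraph \<Rightarrow> ('l, 'k) ipath set" where
  "infinite_paths \<Lambda> = {x.
    (\<forall>p q. p \<le> q \<longrightarrow> x p q \<in> Mor \<Lambda> \<and> deg \<Lambda> (x p q) = q - p \<and>
                   rng \<Lambda> (x p q) = x p p \<and> src \<Lambda> (x p q) = x q q) \<and>
    (\<forall>p q t. p \<le> q \<and> q \<le> t \<longrightarrow> cmp \<Lambda> (x p q) (x q t) = x p t) \<and>
    (\<forall>p q. \<not> p \<le> q \<longrightarrow> x p q = undefined)}"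

definition ip_rng :: "('l, 'k) ipath \<Rightarrow> 'l" where
  "ip_rng x = x 0 0"

definition ip_shift :: "('k \<Rightarrow> nat) \<Rightarrow> ('l, 'k) ipath \<Rightarrow> ('l, 'k) ipath" where
  "ip_shift n x = (\<lambda>p q. x (n + p) (n + q))"

definition concat_path :: "('l, 'k) kgraph \<Rightarrow> 'l \<Rightarrow> ('l, 'k) ipath \<Rightarrow> ('l, 'k) ipath" where
  "concat_path \<Lambda> \<mu> x =
    (THE y. y \<in> infinite_paths \<Lambda> \<and> y 0 (deg \<Lambda> \<mu>) = \<mu> \<and> ip_shift (deg \<Lambda> \<mu>) y = x)"

definition cylinder :: "('l, 'k) kgraph \<Rightarrow> 'l \<Rightarrow> ('l, 'k) ipath set" where
  "cylinder \<Lambda> \<mu> = {concat_path \<Lambda> \<mu> x | x. x \<in> infinite_paths \<Lambda> \<and> src \<Lambda> \<mu> = ip_rng x}"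

definition path_space :: "('l, 'k) kgraph \<Rightarrow> ('l, 'k) ipath topology" where
  "path_space \<Lambda> = topology_generated_by (cylinder \<Lambda> ` Mor \<Lambda>)"


section \<open>Self-similar actions\<close>

text \<open>
  \<open>act g \<mu>\<close> is \<open>g \<cdot> \<mu>\<close> and \<open>res g \<mu>\<close> is the restriction of \<open>g\<close> to \<open>\<mu>\<close>.  The assumption
  \<open>act_composable\<close> says that the right hand side of \<open>act_cmp\<close> is a product of composable
  morphisms, which is implicit in the usual way of writing the latter identity.
\<close>

locale self_similar_k_graph = k_graph \<Lambda> + group_action G "Mor \<Lambda>" act
  for G :: "('g, 'm) monoid_scheme" (structure)
    and \<Lambda> :: "('l, 'k::finite) kgraph"
    and act :: "'g \<Rightarrow> 'l \<Rightarrow> 'l" +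
  fixes res :: "'g \<Rightarrow> 'l \<Rightarrow> 'g"
  assumes deg_act: "\<lbrakk>g \<in> carrier G; \<mu> \<in> Mor \<Lambda>\<rbrakk> \<Longrightarrow> deg \<Lambda> (act g \<mu>) = deg \<Lambda> \<mu>"
    and rng_act: "\<lbrakk>g \<in> carrier G; \<mu> \<in> Mor \<Lambda>\<rbrakk> \<Longrightarrow> rng \<Lambda> (act g \<mu>) = act g (rng \<Lambda> \<mu>)"
    and src_act: "\<lbrakk>g \<in> carrier G; \<mu> \<in> Mor \<Lambda>\<rbrakk> \<Longrightarrow> src \<Lambda> (act g \<mu>) = act g (src \<Lambda> \<mu>)"
    and res_closed: "\<lbrakk>g \<in> carrier G; \<mu> \<in> Mor \<Lambda>\<rbrakk> \<Longrightarrow> res g \<mu> \<in> carrier G"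
    and act_composable: "\<lbrakk>g \<in> carrier G; \<mu> \<in> Mor \<Lambda>; \<nu> \<in> Mor \<Lambda>; src \<Lambda> \<mu> = rng \<Lambda> \<nu>\<rbrakk>
      \<Longrightarrow> src \<Lambda> (act g \<mu>) = rng \<Lambda> (act (res g \<mu>) \<nu>)"
    and act_cmp: "\<lbrakk>g \<in> carrier G; \<mu> \<in> Mor \<Lambda>; \<nu> \<in> Mor \<Lambda>; src \<Lambda> \<mu> = rng \<Lambda> \<nu>\<rbrakk>
      \<Longrightarrow> act g (cmp \<Lambda> \<mu> \<nu>) = cmp \<Lambda> (act g \<mu>) (act (res g \<mu>) \<nu>)"
    and res_cmp: "\<lbrakk>g \<in> carrier G; \<mu> \<in> Mor \<Lambda>; \<nu> \<in> Mor \<Lambda>; src \<Lambda> \<mu> = rng \<Lambda> \<nu>\<rbrakk>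
      \<Longrightarrow> res g (cmp \<Lambda> \<mu> \<nu>) = res (res g \<mu>) \<nu>"
    and res_mult: "\<lbrakk>g \<in> carrier G; h \<in> carrier G; \<mu> \<in> Mor \<Lambda>\<rbrakk>
      \<Longrightarrow> res (g \<otimes> h) \<mu> = res g (act h \<mu>) \<otimes> res h \<mu>"
    and res_vertex: "\<lbrakk>g \<in> carrier G; v \<in> vertices \<Lambda>\<rbrakk> \<Longrightarrow> res g v = g"

definition pseudo_free ::
  "('g, 'm) monoid_scheme \<Rightarrow> ('l, 'k) kgraph \<Rightarrow> ('g \<Rightarrow> 'l \<Rightarrow> 'l) \<Rightarrow> ('g \<Rightarrow> 'l \<Rightarrow> 'g) \<Rightarrow> bool" where
  "pseudo_free G \<Lambda> act res \<longleftrightarrow>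
    (\<forall>g \<in> carrier G. \<forall>\<mu> \<in> Mor \<Lambda>. act g \<mu> = \<mu> \<and> res g \<mu> = \<one>\<^bsub>G\<^esub> \<longrightarrow> g = \<one>\<^bsub>G\<^esub>)"

definition act_ipath ::
  "('g \<Rightarrow> 'l \<Rightarrow> 'l) \<Rightarrow> ('g \<Rightarrow> 'l \<Rightarrow> 'g) \<Rightarrow> 'g \<Rightarrow> ('l, 'k) ipath \<Rightarrow> ('l, 'k) ipath" where
  "act_ipath act res g x =
    (\<lambda>n m. if n \<le> m then act (res g (x 0 n)) (x n m) else undefined)"

definition maximal_tails ::
  "('g, 'm) monoid_scheme \<Rightarrow> ('l, 'k) kgraph \<Rightarrow> ('g \<Rightarrow> 'l \<Rightarrow> 'l) \<Rightarrow> 'l set set" where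
  "maximal_tails G \<Lambda> act = {M. M \<subseteq> vertices \<Lambda> \<and> M \<noteq> {} \<and>
    (\<forall>g \<in> carrier G. \<forall>v \<in> M. act g v \<in> M) \<and>
    (\<forall>v \<in> vertices \<Lambda>. \<forall>w \<in> M. paths_into \<Lambda> v {w} \<noteq> {} \<longrightarrow> v \<in> M) \<and>
    (\<forall>v \<in> M. \<forall>i. \<exists>\<mu> \<in> paths_into \<Lambda> v M. deg \<Lambda> \<mu> = (\<lambda>j. if j = i then 1 else 0)) \<and>
    (\<forall>v \<in> M. \<forall>w \<in> M. \<exists>g \<in> carrier G. \<exists>u \<in> M.
      paths_into \<Lambda> v {u} \<noteq> {} \<and> paths_into \<Lambda> w {act g u} \<noteq> {})}"


section \<open>Graded topological groupoids\<close>

text \<open>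
  Objects and arrows form separate topological spaces; arrows \<open>a\<close>, \<open>b\<close> are composable if
  \<open>gpd_src \<G> a = gpd_rng \<G> b\<close>.
\<close>

record ('u, 'a) top_groupoid =
  unit_top :: "'u topology"
  arrow_top :: "'a topology"
  gpd_rng :: "'a \<Rightarrow> 'u"
  gpd_src :: "'a \<Rightarrow> 'u"
  gpd_mult :: "'a \<Rightarrow> 'a \<Rightarrow> 'a"

definition gpd_orbit :: "('u, 'a) top_groupoid \<Rightarrow> 'u \<Rightarrow> 'u set" where
  "gpd_orbit \<G> x = {gpd_rng \<G> a | a. a \<in> topspace (arrow_top \<G>) \<and> gpd_src \<G> a = x}"

definition reduction_top :: "('u, 'a) top_groupoid \<Rightarrow> 'u set \<Rightarrow> 'a topology" where
  "reduction_top \<G> F =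
    subtopology (arrow_top \<G>) {a \<in> topspace (arrow_top \<G>). gpd_rng \<G> a \<in> F}"

text \<open>\<open>iso_interior \<G> F\<close> is the interior of the isotropy bundle of the reduction of \<open>\<G>\<close>
  to \<open>F\<close>, relative to that reduction.\<close>

definition iso_interior :: "('u, 'a) top_groupoid \<Rightarrow> 'u set \<Rightarrow> 'a set" where
  "iso_interior \<G> F =
    reduction_top \<G> F interior_of {a \<in> topspace (reduction_top \<G> F). gpd_rng \<G> a = gpd_src \<G> a}"

definition essentially_central_isotropy ::
  "('u, 'a) top_groupoid \<Rightarrow> ('a \<Rightarrow> 'c::group_add) \<Rightarrow> bool" where
  "essentially_central_isotropy \<G> \<Phi> \<longleftrightarrow>
    (\<forall>x \<in> topspace (unit_top \<G>).
      let I = {a \<in> iso_interior \<G> (unit_top \<G> closure_of gpd_orbit \<G> x). gpd_src \<G> a = x}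
      in inj_on \<Phi> I \<and> \<Phi> ` I \<subseteq> {c. \<forall>b. c + b = b + c})"


section \<open>The Exel--Pardo groupoid\<close>

text \<open>
  The elements of \<open>Q\<^sub>k(G)\<close> are the equivalence classes \<open>tail_class G f\<close> of functions
  \<open>f\<close> with values in \<open>carrier G\<close>; the product and the automorphisms \<open>\<T>\<^sub>m\<close> are
  obtained by lifting the operations on representatives to classes.
\<close>

definition tail_class ::
  "('g, 'm) monoid_scheme \<Rightarrow> (('k \<Rightarrow> nat) \<Rightarrow> 'g) \<Rightarrow> (('k \<Rightarrow> nat) \<Rightarrow> 'g) set" where
  "tail_class G f = {f'. range f' \<subseteq> carrier G \<and> (\<exists>m. \<forall>n. m \<le> n \<longrightarrow> f' n = f n)}"

definition Q_mult ::
  "('g, 'm) monoid_scheme \<Rightarrow> (('k \<Rightarrow> nat) \<Rightarrow> 'g) set \<Rightarrow> (('k \<Rightarrow> nat) \<Rightarrow> 'g) set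
    \<Rightarrow> (('k \<Rightarrow> nat) \<Rightarrow> 'g) set" where
  "Q_mult G q q' = (\<Union>f \<in> q. \<Union>f' \<in> q'. tail_class G (\<lambda>n. f n \<otimes>\<^bsub>G\<^esub> f' n))"

definition shift_fun ::
  "('g, 'm) monoid_scheme \<Rightarrow> ('k \<Rightarrow> int) \<Rightarrow> (('k \<Rightarrow> nat) \<Rightarrow> 'g) \<Rightarrow> ('k \<Rightarrow> nat) \<Rightarrow> 'g" where
  "shift_fun G m f = (\<lambda>n. if \<forall>i. m i \<le> int (n i) then f (\<lambda>i. nat (int (n i) - m i)) else \<one>\<^bsub>G\<^esub>)"

definition Q_shift ::
  "('g, 'm) monoid_scheme \<Rightarrow> ('k \<Rightarrow> int) \<Rightarrow> (('k \<Rightarrow> nat) \<Rightarrow> 'g) set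
    \<Rightarrow> (('k \<Rightarrow> nat) \<Rightarrow> 'g) set" where
  "Q_shift G m q = (\<Union>f \<in> q. tail_class G (shift_fun G m f))"

definition res_ipath ::
  "('g, 'm) monoid_scheme \<Rightarrow> ('g \<Rightarrow> 'l \<Rightarrow> 'g) \<Rightarrow> 'g \<Rightarrow> ('l, 'k) ipath
    \<Rightarrow> (('k \<Rightarrow> nat) \<Rightarrow> 'g) set" where
  "res_ipath G res g x = tail_class G (\<lambda>n. res g (x 0 n))"

type_synonym ('g, 'l, 'k) ep_arrow =
  "('l, 'k) ipath \<times> (('k \<Rightarrow> nat) \<Rightarrow> 'g) set \<times> ('k \<Rightarrow> int) \<times> ('l, 'k) ipath"

definition deg_int :: "('l, 'k) kgraph \<Rightarrow> 'l \<Rightarrow> 'k \<Rightarrow> int" where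
  "deg_int \<Lambda> \<mu> = (\<lambda>i. int (deg \<Lambda> \<mu> i))"

definition ep_basic ::
  "('g, 'm) monoid_scheme \<Rightarrow> ('l, 'k) kgraph \<Rightarrow> ('g \<Rightarrow> 'l \<Rightarrow> 'l) \<Rightarrow> ('g \<Rightarrow> 'l \<Rightarrow> 'g)
    \<Rightarrow> 'l \<Rightarrow> 'g \<Rightarrow> 'l \<Rightarrow> ('g, 'l, 'k) ep_arrow set" where
  "ep_basic G \<Lambda> act res \<mu> g \<nu> =
    {(concat_path \<Lambda> \<mu> (act_ipath act res g x),
      Q_shift G (deg_int \<Lambda> \<mu>) (res_ipath G res g x),
      deg_int \<Lambda> \<mu> - deg_int \<Lambda> \<nu>,
      concat_path \<Lambda> \<nu> x) | x.
     x \<in> infinite_paths \<Lambda> \<and> src \<Lambda> \<nu> = ip_rng x \<and> src \<Lambda> \<mu> = act g (ip_rng x)}"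

text \<open>
  The set of arrows, which is the union of the sets \<open>ep_basic\<close>, is the underlying set of
  \<open>arrow_top\<close>.  The unit at \<open>x\<close> is the arrow \<open>(x, [1], 0, x)\<close>.
\<close>

definition exel_pardo_groupoid ::
  "('g, 'm) monoid_scheme \<Rightarrow> ('l, 'k) kgraph \<Rightarrow> ('g \<Rightarrow> 'l \<Rightarrow> 'l) \<Rightarrow> ('g \<Rightarrow> 'l \<Rightarrow> 'g)
    \<Rightarrow> (('l, 'k) ipath, ('g, 'l, 'k) ep_arrow) top_groupoid" where
  "exel_pardo_groupoid G \<Lambda> act res =
    \<lparr> unit_top = path_space \<Lambda>,
      arrow_top = topology_generated_by
        {ep_basic G \<Lambda> act res \<mu> g \<nu> | \<mu> g \<nu>. \<mu> \<in> Mor \<Lambda> \<and> g \<in> carrier G \<and> \<nu> \<in> Mor \<Lambda>},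
      gpd_rng = (\<lambda>(x, q, m, y). x),
      gpd_src = (\<lambda>(x, q, m, y). y),
      gpd_mult = (\<lambda>(x, q, m, y) (y', q', n, z). (x, Q_mult G q (Q_shift G m q'), m + n, z)) \<rparr>"

definition standard_grading :: "('g, 'l, 'k) ep_arrow \<Rightarrow> 'k \<Rightarrow> int" where
  "standard_grading = (\<lambda>(y, q, n, z). n)"

end

theory Submission
  imports Defs
begin

text \<open>
  Isotropy of the groupoid over an orbit closure can be read off from the tail of a path.  The
  tail of an infinite path \<open>x\<close> consists of the vertices that reach some translate
  \<open>g \<cdot> x(n)\<close>.  It is a maximal \<open>G\<close>-tail, every maximal \<open>G\<close>-tail \<open>M\<close> of a countable graph arises in
  this way, and \<open>x\<close> can then be chosen to begin with any given path that ends in \<open>M\<close>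
  (\<open>tail_of_maximal\<close>, \<open>maximal_tail_eq_tail_of\<close>).  The closure of the orbit of \<open>x\<close> is the set of
  infinite paths all of whose vertices lie in the tail of \<open>x\<close> (\<open>orbit_closure\<close>).  The paths in
  \<open>v\<Lambda>M\<close> are therefore precisely the initial segments of the paths from \<open>v\<close> in the orbit closure.

  Suppose that \<open>g\<close> acts trivially on \<open>v\<Lambda>M\<close>, where \<open>M\<close> is the tail of a path \<open>x\<close> from \<open>v\<close>.  Then
  \<open>g \<cdot> z = z\<close> for all \<open>z\<close> from \<open>v\<close> in the orbit closure, so the arrow given by \<open>(v, g, v)\<close> at \<open>x\<close> is
  interior to the isotropy (\<open>trivial_action_iso_interior\<close>).  It has degree \<open>0\<close>, as has the unit at
  \<open>x\<close>.  If the grading is injective there, the two agree, and pseudo-freeness yields \<open>g = 1\<close>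
  (\<open>germ_eq_unit\<close>).

  Conversely, consider two arrows of the same degree in the interior of the isotropy at \<open>x\<close>.
  Lengthening a representation \<open>(\<mu>, g, \<nu>)\<close> of an arrow along its source path gives arbitrarily
  small basic neighbourhoods (\<open>germ_neighbourhood\<close>), and since the degrees agree, the lengthened
  representations can be taken to be \<open>(\<mu>, g, \<nu>)\<close> and \<open>(\<mu>, h, \<nu>)\<close> with common \<open>\<mu>\<close> and \<open>\<nu>\<close>.  As
  both neighbourhoods consist of isotropy over the orbit closure, \<open>g\<close> and \<open>h\<close> act equally on the
  paths inside the tail that start at the source of \<open>\<nu>\<close>.  The condition on the tail forces \<open>g = h\<close>
  (\<open>iso_interior_inj\<close>).
\<close>


section \<open>Degrees\<close>

lemma zero_le_degree [simp]: "0 \<le> (n :: 'k \<Rightarrow> nat)"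
  by (simp add: le_fun_def)

lemma le_add_degree [simp]: "m \<le> m + (n :: 'k \<Rightarrow> nat)" "m \<le> n + (m :: 'k \<Rightarrow> nat)"
  by (simp_all add: le_fun_def)

lemma add_diff_degree: "m \<le> n \<Longrightarrow> m + (n - m) = (n :: 'k \<Rightarrow> nat)"
  by (auto simp: le_fun_def fun_eq_iff)


section \<open>Initial segments and infinite paths\<close>

context k_graph
begin

lemma factor_unique:
  assumes "\<alpha> \<in> Mor \<Lambda>" "\<beta> \<in> Mor \<Lambda>" "src \<Lambda> \<alpha> = rng \<Lambda> \<beta>"
    and "\<alpha>' \<in> Mor \<Lambda>" "\<beta>' \<in> Mor \<Lambda>" "src \<Lambda> \<alpha>' = rng \<Lambda> \<beta>'"
    and eq: "cmp \<Lambda> \<alpha> \<beta> = cmp \<Lambda> \<alpha>' \<beta>'" and deg: "deg \<Lambda> \<alpha> = deg \<Lambda> \<alpha>'"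
  shows "\<alpha> = \<alpha>'" "\<beta> = \<beta>'"
proof -
  have "deg \<Lambda> \<alpha> + deg \<Lambda> \<beta> = deg \<Lambda> \<alpha>' + deg \<Lambda> \<beta>'"
    using assms deg_cmp by metis
  then have "deg \<Lambda> \<beta> = deg \<Lambda> \<beta>'"
    using deg by simp
  moreover have "\<exists>!p. fst p \<in> Mor \<Lambda> \<and> snd p \<in> Mor \<Lambda> \<and> src \<Lambda> (fst p) = rng \<Lambda> (snd p) \<and>
      deg \<Lambda> (fst p) = deg \<Lambda> \<alpha> \<and> deg \<Lambda> (snd p) = deg \<Lambda> \<beta> \<and>
      cmp \<Lambda> \<alpha> \<beta> = cmp \<Lambda> (fst p) (snd p)"
    by (rule factorization) (use assms(1-3) in \<open>simp_all add: cmp_closed deg_cmp\<close>)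
  ultimately have "(\<alpha>, \<beta>) = (\<alpha>', \<beta>')"
    using assms by (smt (verit) fst_conv snd_conv)
  then show "\<alpha> = \<alpha>'" "\<beta> = \<beta>'"
    by simp_all
qed

lemma obtain_factor:
  assumes "\<mu> \<in> Mor \<Lambda>" "n \<le> deg \<Lambda> \<mu>"
  obtains \<alpha> \<beta> where "\<alpha> \<in> Mor \<Lambda>" "\<beta> \<in> Mor \<Lambda>" "src \<Lambda> \<alpha> = rng \<Lambda> \<beta>" "deg \<Lambda> \<alpha> = n" "\<mu> = cmp \<Lambda> \<alpha> \<beta>"
proof -
  have "deg \<Lambda> \<mu> = n + (deg \<Lambda> \<mu> - n)"
    using assms by (simp add: add_diff_degree)
  from factorization[OF assms(1) this] show ?thesis
    using that by blast
qed

lemma vertex_rng_src: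
  assumes "v \<in> vertices \<Lambda>"
  shows "v \<in> Mor \<Lambda>" "deg \<Lambda> v = 0" "rng \<Lambda> v = v" "src \<Lambda> v = v"
proof -
  show v: "v \<in> Mor \<Lambda>" "deg \<Lambda> v = 0"
    using assms by (auto simp: vertices_def)
  have eq: "cmp \<Lambda> (rng \<Lambda> v) v = cmp \<Lambda> v (src \<Lambda> v)"
    using v by (simp add: cmp_rng cmp_src)
  show "rng \<Lambda> v = v"
    by (rule factor_unique(1)[OF _ _ _ _ _ _ eq])
      (use v in \<open>simp_all add: rng_closed src_closed rng_src src_rng deg_rng\<close>)
  show "src \<Lambda> v = v"
    by (rule factor_unique(2)[OF _ _ _ _ _ _ eq, symmetric])
      (use v in \<open>simp_all add: rng_closed src_closed rng_src src_rng deg_rng\<close>)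
qed

lemma src_in_vertices: "\<mu> \<in> Mor \<Lambda> \<Longrightarrow> src \<Lambda> \<mu> \<in> vertices \<Lambda>"
  by (auto simp: vertices_def src_closed deg_src)

definition is_prefix :: "'l \<Rightarrow> 'l \<Rightarrow> bool" where
  "is_prefix \<alpha> \<mu> \<longleftrightarrow> \<alpha> \<in> Mor \<Lambda> \<and> (\<exists>\<beta> \<in> Mor \<Lambda>. src \<Lambda> \<alpha> = rng \<Lambda> \<beta> \<and> \<mu> = cmp \<Lambda> \<alpha> \<beta>)"

lemma is_prefix_cmp:
  "\<lbrakk>\<alpha> \<in> Mor \<Lambda>; \<beta> \<in> Mor \<Lambda>; src \<Lambda> \<alpha> = rng \<Lambda> \<beta>\<rbrakk> \<Longrightarrow> is_prefix \<alpha> (cmp \<Lambda> \<alpha> \<beta>)"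
  by (auto simp: is_prefix_def)

lemma is_prefix_refl: "\<mu> \<in> Mor \<Lambda> \<Longrightarrow> is_prefix \<mu> \<mu>"
  using is_prefix_cmp[of \<mu> "src \<Lambda> \<mu>"] by (simp add: src_closed rng_src cmp_src)

lemma is_prefix_closed: "is_prefix \<alpha> \<mu> \<Longrightarrow> \<alpha> \<in> Mor \<Lambda> \<and> \<mu> \<in> Mor \<Lambda>"
  by (auto simp: is_prefix_def cmp_closed)

lemma is_prefix_trans:
  assumes "is_prefix \<alpha> \<beta>" "is_prefix \<beta> \<gamma>"
  shows "is_prefix \<alpha> \<gamma>"
proof -
  obtain \<mu> \<nu> where "\<alpha> \<in> Mor \<Lambda>" "\<mu> \<in> Mor \<Lambda>" "src \<Lambda> \<alpha> = rng \<Lambda> \<mu>" "\<beta> = cmp \<Lambda> \<alpha> \<mu>"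
    "\<nu> \<in> Mor \<Lambda>" "src \<Lambda> \<beta> = rng \<Lambda> \<nu>" "\<gamma> = cmp \<Lambda> \<beta> \<nu>"
    using assms by (auto simp: is_prefix_def)
  then show ?thesis
    using is_prefix_cmp[of \<alpha> "cmp \<Lambda> \<mu> \<nu>"] by (simp add: cmp_closed src_cmp rng_cmp cmp_assoc)
qed

lemma is_prefix_unique: "\<lbrakk>is_prefix \<alpha> \<mu>; is_prefix \<beta> \<mu>; deg \<Lambda> \<alpha> = deg \<Lambda> \<beta>\<rbrakk> \<Longrightarrow> \<alpha> = \<beta>"
  unfolding is_prefix_def using factor_unique by metis

lemma obtain_prefix:
  assumes "\<mu> \<in> Mor \<Lambda>" "n \<le> deg \<Lambda> \<mu>"
  obtains \<alpha> where "is_prefix \<alpha> \<mu>" "deg \<Lambda> \<alpha> = n"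
  using obtain_factor[OF assms] is_prefix_cmp by metis

lemma is_prefix_linear:
  assumes "is_prefix \<alpha> \<mu>" "is_prefix \<beta> \<mu>" "deg \<Lambda> \<alpha> \<le> deg \<Lambda> \<beta>"
  shows "is_prefix \<alpha> \<beta>"
proof -
  obtain \<alpha>' where "is_prefix \<alpha>' \<beta>" "deg \<Lambda> \<alpha>' = deg \<Lambda> \<alpha>"
    using assms is_prefix_closed obtain_prefix by metis
  then show ?thesis
    using assms is_prefix_trans is_prefix_unique by metis
qed

lemma ipath_morphism:
  assumes "x \<in> infinite_paths \<Lambda>" "p \<le> q"
  shows "x p q \<in> Mor \<Lambda>" "deg \<Lambda> (x p q) = q - p" "rng \<Lambda> (x p q) = x p p" "src \<Lambda> (x p q) = x q q"
  using assms by (auto simp: infinite_paths_def)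

lemma ipath_cmp:
  "\<lbrakk>x \<in> infinite_paths \<Lambda>; p \<le> q; q \<le> t\<rbrakk> \<Longrightarrow> cmp \<Lambda> (x p q) (x q t) = x p t"
  by (auto simp: infinite_paths_def)

lemma ipath_vertex: "x \<in> infinite_paths \<Lambda> \<Longrightarrow> x n n \<in> vertices \<Lambda>"
  by (auto simp: vertices_def ipath_morphism)

lemma ipath_initial:
  assumes "x \<in> infinite_paths \<Lambda>"
  shows "x 0 n \<in> Mor \<Lambda>" "deg \<Lambda> (x 0 n) = n" "rng \<Lambda> (x 0 n) = ip_rng x" "src \<Lambda> (x 0 n) = x n n"
  using ipath_morphism[OF assms, of 0 n] by (auto simp: ip_rng_def fun_eq_iff)

lemma ipath_prefix: "\<lbrakk>x \<in> infinite_paths \<Lambda>; p \<le> q\<rbrakk> \<Longrightarrow> is_prefix (x 0 p) (x 0 q)"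
  using is_prefix_cmp[of "x 0 p" "x p q"] by (simp add: ipath_initial ipath_morphism ipath_cmp)

lemma ipath_eqI:
  assumes x: "x \<in> infinite_paths \<Lambda>" and y: "y \<in> infinite_paths \<Lambda>"
    and eq: "\<And>n. x 0 (N + n) = y 0 (N + n)"
  shows "x = y"
proof -
  have initial: "x 0 n = y 0 n" for n
    using ipath_prefix[OF x, of n "N + n"] ipath_prefix[OF y, of n "N + n"] eq[of n]
    by (metis is_prefix_unique ipath_initial(2) le_add_degree(2) x y)
  show ?thesis
  proof (intro ext)
    fix p q
    show "x p q = y p q"
    proof (cases "p \<le> q")
      case True
      have "cmp \<Lambda> (x 0 p) (x p q) = cmp \<Lambda> (y 0 p) (y p q)"
        using ipath_cmp[OF x, of 0 p q] ipath_cmp[OF y, of 0 p q] True initial by simp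
      then show ?thesis
        using factor_unique(2)[of "x 0 p" "x p q" "y 0 p" "y p q"] True initial
          ipath_initial(4)[OF x, of p] ipath_initial(4)[OF y, of p]
        by (simp add: x y ipath_initial ipath_morphism)
    next
      case False
      then show ?thesis
        using x y by (simp add: infinite_paths_def)
    qed
  qed
qed

text \<open>
  An infinite path amounts to a coherent choice of initial segments of all degrees: its
  value at \<open>(p, q)\<close> is the unique morphism that completes the segment of degree \<open>p\<close> to that of
  degree \<open>q\<close>.  Any family of morphisms that is directed under the prefix order and of unbounded
  degrees determines such a choice.  Concatenations and the paths that exhaust a maximal tail are
  obtained in this way.
\<close>

lemma ipath_of_directed:
  assumes directed: "\<forall>\<alpha> \<in> S. \<forall>\<beta> \<in> S. \<exists>\<gamma> \<in> S. is_prefix \<alpha> \<gamma> \<and> is_prefix \<beta> \<gamma>"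
    and cofinal: "\<forall>n. \<exists>\<alpha> \<in> S. n \<le> deg \<Lambda> \<alpha>"
  obtains x where "x \<in> infinite_paths \<Lambda>" "\<forall>\<alpha> \<in> S. x 0 (deg \<Lambda> \<alpha>) = \<alpha>"
proof -
  have closed: "\<alpha> \<in> Mor \<Lambda>" if "\<alpha> \<in> S" for \<alpha>
    using directed that is_prefix_closed by blast
  have "\<exists>\<pi>. deg \<Lambda> \<pi> = n \<and> (\<exists>\<alpha> \<in> S. is_prefix \<pi> \<alpha>)" for n
    using cofinal closed obtain_prefix by metis
  then obtain P where P: "\<And>n. deg \<Lambda> (P n) = n" "\<And>n. \<exists>\<alpha> \<in> S. is_prefix (P n) \<alpha>"
    by metis
  have P_Mor: "P n \<in> Mor \<Lambda>" for n
    using P(2) is_prefix_closed by blast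
  have P_prefix: "is_prefix (P p) (P q)" if pq: "p \<le> q" for p q
  proof -
    obtain \<alpha> \<beta> where "\<alpha> \<in> S" "is_prefix (P p) \<alpha>" "\<beta> \<in> S" "is_prefix (P q) \<beta>"
      using P(2) by metis
    moreover from this obtain \<gamma> where "is_prefix \<alpha> \<gamma>" "is_prefix \<beta> \<gamma>"
      using directed by blast
    ultimately show ?thesis
      using is_prefix_linear[of "P p" \<gamma> "P q"] is_prefix_trans P(1) pq by metis
  qed
  then have "\<exists>\<nu>. p \<le> q \<longrightarrow> \<nu> \<in> Mor \<Lambda> \<and> src \<Lambda> (P p) = rng \<Lambda> \<nu> \<and> P q = cmp \<Lambda> (P p) \<nu>" for p q
    unfolding is_prefix_def by blast
  then obtain y where y: "\<And>p q. p \<le> q \<Longrightarrow>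
      y p q \<in> Mor \<Lambda> \<and> src \<Lambda> (P p) = rng \<Lambda> (y p q) \<and> P q = cmp \<Lambda> (P p) (y p q)"
    by metis
  define x where "x = (\<lambda>p q. if p \<le> q then y p q else undefined)"
  have x: "x p q \<in> Mor \<Lambda>" "rng \<Lambda> (x p q) = src \<Lambda> (P p)" "cmp \<Lambda> (P p) (x p q) = P q"
    "src \<Lambda> (x p q) = src \<Lambda> (P q)" "deg \<Lambda> (x p q) = q - p" if "p \<le> q" for p q
  proof -
    show *: "x p q \<in> Mor \<Lambda>" "rng \<Lambda> (x p q) = src \<Lambda> (P p)" "cmp \<Lambda> (P p) (x p q) = P q"
      using y[OF that] that by (auto simp: x_def)
    then show "src \<Lambda> (x p q) = src \<Lambda> (P q)"
      using src_cmp P_Mor by metis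
    have "q = p + deg \<Lambda> (x p q)"
      using * deg_cmp[of "P p" "x p q"] P P_Mor by simp
    then show "deg \<Lambda> (x p q) = q - p"
      by (metis add_diff_cancel_left')
  qed
  have x_vertex: "x p p = src \<Lambda> (P p)" for p
    using x[of p p] vertex_rng_src[of "x p p"] by (simp add: vertices_def)
  have x_cmp: "cmp \<Lambda> (x p q) (x q t) = x p t" if "p \<le> q" "q \<le> t" for p q t
  proof -
    have pt: "p \<le> t"
      using that by simp
    have "cmp \<Lambda> (P p) (cmp \<Lambda> (x p q) (x q t)) = cmp \<Lambda> (P p) (x p t)"
      using x[OF that(1)] x[OF that(2)] x[OF pt] P_Mor cmp_assoc[of "P p" "x p q" "x q t"] by simp
    show ?thesis
      by (rule factor_unique(2)[OF _ _ _ _ _ _ \<open>cmp \<Lambda> (P p) _ = _\<close> refl])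
        (simp_all add: cmp_closed rng_cmp P_Mor x that pt)
  qed
  have "x \<in> infinite_paths \<Lambda>"
    unfolding infinite_paths_def
  proof (intro CollectI conjI allI impI)
    show "x p q = undefined" if "\<not> p \<le> q" for p q
      using that by (simp add: x_def)
  qed (simp_all add: x x_vertex x_cmp)
  moreover have "x 0 n = P n" for n
  proof -
    have "P 0 \<in> vertices \<Lambda>"
      using P P_Mor by (simp add: vertices_def)
    then show ?thesis
      using x[of 0 n] vertex_rng_src[of "P 0"] cmp_rng[of "x 0 n"] by simp
  qed
  moreover have "P (deg \<Lambda> \<alpha>) = \<alpha>" if "\<alpha> \<in> S" for \<alpha>
  proof -
    obtain \<beta> where "\<beta> \<in> S" "is_prefix (P (deg \<Lambda> \<alpha>)) \<beta>"
      using P(2) by metis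
    moreover from this obtain \<gamma> where "is_prefix \<alpha> \<gamma>" "is_prefix \<beta> \<gamma>"
      using directed \<open>\<alpha> \<in> S\<close> by blast
    ultimately show ?thesis
      using is_prefix_unique is_prefix_trans P(1) by metis
  qed
  ultimately show ?thesis
    using that by metis
qed

lemma ip_shift_closed: "x \<in> infinite_paths \<Lambda> \<Longrightarrow> ip_shift n x \<in> infinite_paths \<Lambda>"
  by (auto simp: infinite_paths_def ip_shift_def)

lemma ip_rng_shift: "ip_rng (ip_shift n x) = x n n"
  by (simp add: ip_rng_def ip_shift_def)

lemma ipath_shift_split:
  "x \<in> infinite_paths \<Lambda> \<Longrightarrow> x 0 (n + m) = cmp \<Lambda> (x 0 n) (ip_shift n x 0 m)"
  by (simp add: ip_shift_def ipath_cmp)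

lemma shift_unique:
  assumes "x \<in> infinite_paths \<Lambda>" "y \<in> infinite_paths \<Lambda>"
    and "x 0 n = y 0 n" "ip_shift n x = ip_shift n y"
  shows "x = y"
  by (rule ipath_eqI[of _ _ n]) (simp_all add: assms ipath_shift_split)

text \<open>
  The initial segments \<open>\<mu>x(0, n)\<close> form a directed family, and the path that they determine is
  the concatenation of \<open>\<mu>\<close> and \<open>x\<close>.
\<close>

lemma concat_path_exists:
  assumes \<mu>: "\<mu> \<in> Mor \<Lambda>" and x: "x \<in> infinite_paths \<Lambda>" and sr: "src \<Lambda> \<mu> = ip_rng x"
  shows "\<exists>y. y \<in> infinite_paths \<Lambda> \<and> y 0 (deg \<Lambda> \<mu>) = \<mu> \<and> ip_shift (deg \<Lambda> \<mu>) y = x"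
proof -
  define S where "S = range (\<lambda>n. cmp \<Lambda> \<mu> (x 0 n))"
  have deg_S: "deg \<Lambda> (cmp \<Lambda> \<mu> (x 0 n)) = deg \<Lambda> \<mu> + n" for n
    by (simp add: deg_cmp \<mu> x sr ipath_initial)
  have mono: "is_prefix (cmp \<Lambda> \<mu> (x 0 n)) (cmp \<Lambda> \<mu> (x 0 m))" if "n \<le> m" for n m
  proof -
    have "cmp \<Lambda> \<mu> (x 0 m) = cmp \<Lambda> (cmp \<Lambda> \<mu> (x 0 n)) (x n m)"
      using that by (simp add: cmp_assoc \<mu> x sr ipath_initial ipath_morphism ipath_cmp)
    then show ?thesis
      using that by (simp add: is_prefix_cmp cmp_closed src_cmp \<mu> x sr ipath_initial ipath_morphism)
  qed
  have directed: "\<forall>\<alpha> \<in> S. \<forall>\<beta> \<in> S. \<exists>\<gamma> \<in> S. is_prefix \<alpha> \<gamma> \<and> is_prefix \<beta> \<gamma>"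
    unfolding S_def using mono le_add_degree by blast
  have cofinal: "\<forall>n. \<exists>\<alpha> \<in> S. n \<le> deg \<Lambda> \<alpha>"
    unfolding S_def by (metis deg_S le_add_degree(2) rangeI)
  obtain y where y: "y \<in> infinite_paths \<Lambda>" "\<forall>\<alpha> \<in> S. y 0 (deg \<Lambda> \<alpha>) = \<alpha>"
    using ipath_of_directed[OF directed cofinal] by blast
  have y_initial: "y 0 (deg \<Lambda> \<mu> + n) = cmp \<Lambda> \<mu> (x 0 n)" for n
    using y(2) deg_S unfolding S_def by (metis rangeI)
  have "cmp \<Lambda> \<mu> (x 0 0) = \<mu>"
    using cmp_src[OF \<mu>] sr by (simp add: ip_rng_def)
  then have y_\<mu>: "y 0 (deg \<Lambda> \<mu>) = \<mu>"
    using y_initial[of 0] by simp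
  have "ip_shift (deg \<Lambda> \<mu>) y = x"
  proof (rule ipath_eqI[of _ _ 0])
    fix n
    have shift: "ip_shift (deg \<Lambda> \<mu>) y \<in> infinite_paths \<Lambda>"
      by (rule ip_shift_closed) fact
    have "src \<Lambda> \<mu> = y (deg \<Lambda> \<mu>) (deg \<Lambda> \<mu>)"
      using ipath_initial(4)[OF y(1), of "deg \<Lambda> \<mu>"] y_\<mu> by simp
    then have "src \<Lambda> \<mu> = ip_rng (ip_shift (deg \<Lambda> \<mu>) y)"
      by (simp add: ip_rng_shift)
    then have "ip_shift (deg \<Lambda> \<mu>) y 0 n = x 0 n"
      using factor_unique(2)[of \<mu> "ip_shift (deg \<Lambda> \<mu>) y 0 n" \<mu> "x 0 n"]
        ipath_shift_split[OF y(1), of "deg \<Lambda> \<mu>" n] y_initial[of n] y_\<mu>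
      by (simp add: \<mu> x shift sr ipath_initial)
    then show "ip_shift (deg \<Lambda> \<mu>) y 0 (0 + n) = x 0 (0 + n)"
      by simp
  qed (use x y ip_shift_closed in auto)
  then show ?thesis
    using y y_\<mu> by blast
qed

lemma concat_path:
  assumes "\<mu> \<in> Mor \<Lambda>" "x \<in> infinite_paths \<Lambda>" "src \<Lambda> \<mu> = ip_rng x"
  shows concat_path_closed: "concat_path \<Lambda> \<mu> x \<in> infinite_paths \<Lambda>"
    and concat_path_initial: "concat_path \<Lambda> \<mu> x 0 (deg \<Lambda> \<mu>) = \<mu>"
    and shift_concat_path: "ip_shift (deg \<Lambda> \<mu>) (concat_path \<Lambda> \<mu> x) = x"
proof -
  have "\<exists>!y. y \<in> infinite_paths \<Lambda> \<and> y 0 (deg \<Lambda> \<mu>) = \<mu> \<and> ip_shift (deg \<Lambda> \<mu>) y = x"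
    using concat_path_exists[OF assms] shift_unique by metis
  from theI'[OF this] show "concat_path \<Lambda> \<mu> x \<in> infinite_paths \<Lambda>"
    "concat_path \<Lambda> \<mu> x 0 (deg \<Lambda> \<mu>) = \<mu>" "ip_shift (deg \<Lambda> \<mu>) (concat_path \<Lambda> \<mu> x) = x"
    by (simp_all add: concat_path_def)
qed

lemma concat_path_segment:
  assumes "\<mu> \<in> Mor \<Lambda>" "x \<in> infinite_paths \<Lambda>" "src \<Lambda> \<mu> = ip_rng x"
  shows "concat_path \<Lambda> \<mu> x 0 (deg \<Lambda> \<mu> + n) = cmp \<Lambda> \<mu> (x 0 n)"
  using ipath_shift_split[OF concat_path_closed[OF assms], of "deg \<Lambda> \<mu>" n]
  by (simp add: concat_path_initial shift_concat_path assms)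

lemma concat_path_vertex:
  assumes "\<mu> \<in> Mor \<Lambda>" "x \<in> infinite_paths \<Lambda>" "src \<Lambda> \<mu> = ip_rng x"
  shows "concat_path \<Lambda> \<mu> x (deg \<Lambda> \<mu> + n) (deg \<Lambda> \<mu> + n) = x n n"
  using shift_concat_path[OF assms] by (auto simp: ip_shift_def fun_eq_iff)

lemma ip_rng_concat_path:
  assumes "\<mu> \<in> Mor \<Lambda>" "x \<in> infinite_paths \<Lambda>" "src \<Lambda> \<mu> = ip_rng x"
  shows "ip_rng (concat_path \<Lambda> \<mu> x) = rng \<Lambda> \<mu>"
  using ipath_initial(3)[OF concat_path_closed[OF assms], of "deg \<Lambda> \<mu>"] concat_path_initial[OF assms]
  by simp

lemma concat_path_shift:
  assumes "x \<in> infinite_paths \<Lambda>"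
  shows "concat_path \<Lambda> (x 0 n) (ip_shift n x) = x"
proof -
  have *: "x 0 n \<in> Mor \<Lambda>" "ip_shift n x \<in> infinite_paths \<Lambda>" "src \<Lambda> (x 0 n) = ip_rng (ip_shift n x)"
    by (simp_all add: assms ip_shift_closed ipath_initial ip_rng_shift)
  show ?thesis
    using shift_unique[OF concat_path_closed[OF *] assms, of n] concat_path_initial[OF *]
      shift_concat_path[OF *] by (simp add: ipath_initial assms)
qed

lemma concat_path_cmp:
  assumes "\<mu> \<in> Mor \<Lambda>" "\<nu> \<in> Mor \<Lambda>" "src \<Lambda> \<mu> = rng \<Lambda> \<nu>"
    and "x \<in> infinite_paths \<Lambda>" "src \<Lambda> \<nu> = ip_rng x"
  shows "concat_path \<Lambda> (cmp \<Lambda> \<mu> \<nu>) x = concat_path \<Lambda> \<mu> (concat_path \<Lambda> \<nu> x)"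
proof (rule ipath_eqI[of _ _ "deg \<Lambda> \<mu> + deg \<Lambda> \<nu>"])
  fix n
  have "concat_path \<Lambda> (cmp \<Lambda> \<mu> \<nu>) x 0 (deg \<Lambda> \<mu> + deg \<Lambda> \<nu> + n) = cmp \<Lambda> (cmp \<Lambda> \<mu> \<nu>) (x 0 n)"
    using concat_path_segment[of "cmp \<Lambda> \<mu> \<nu>" x n] assms by (simp add: cmp_closed src_cmp deg_cmp)
  also have "\<dots> = concat_path \<Lambda> \<mu> (concat_path \<Lambda> \<nu> x) 0 (deg \<Lambda> \<mu> + (deg \<Lambda> \<nu> + n))"
    using assms by (simp add: concat_path_segment concat_path_closed ip_rng_concat_path cmp_assoc
        ipath_initial)
  finally show "concat_path \<Lambda> (cmp \<Lambda> \<mu> \<nu>) x 0 (deg \<Lambda> \<mu> + deg \<Lambda> \<nu> + n) =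
      concat_path \<Lambda> \<mu> (concat_path \<Lambda> \<nu> x) 0 (deg \<Lambda> \<mu> + deg \<Lambda> \<nu> + n)"
    by (simp add: add.assoc)
qed (use assms in \<open>auto simp: concat_path_closed cmp_closed src_cmp ip_rng_concat_path\<close>)

lemma cylinder_eq:
  assumes "\<mu> \<in> Mor \<Lambda>"
  shows "cylinder \<Lambda> \<mu> = {y \<in> infinite_paths \<Lambda>. y 0 (deg \<Lambda> \<mu>) = \<mu>}"
proof (rule equalityI; rule subsetI)
  fix y assume "y \<in> cylinder \<Lambda> \<mu>"
  then show "y \<in> {y \<in> infinite_paths \<Lambda>. y 0 (deg \<Lambda> \<mu>) = \<mu>}"
    using assms by (auto simp: cylinder_def concat_path)
next
  fix y assume y: "y \<in> {y \<in> infinite_paths \<Lambda>. y 0 (deg \<Lambda> \<mu>) = \<mu>}"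
  then have "y = concat_path \<Lambda> \<mu> (ip_shift (deg \<Lambda> \<mu>) y)"
    using concat_path_shift[of y "deg \<Lambda> \<mu>"] by simp
  moreover have "src \<Lambda> \<mu> = ip_rng (ip_shift (deg \<Lambda> \<mu>) y)"
    using y ipath_initial(4)[of y "deg \<Lambda> \<mu>"] by (simp add: ip_rng_shift)
  ultimately show "y \<in> cylinder \<Lambda> \<mu>"
    using y ip_shift_closed unfolding cylinder_def by blast
qed

lemma topspace_path_space: "topspace (path_space \<Lambda>) = infinite_paths \<Lambda>"
proof -
  have "y \<in> cylinder \<Lambda> (y 0 0)" "y 0 0 \<in> Mor \<Lambda>" if "y \<in> infinite_paths \<Lambda>" for y
    using that ipath_initial[OF that, of 0] by (auto simp: cylinder_eq)
  then show ?thesis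
    unfolding path_space_def by (auto simp: cylinder_eq)
qed

lemma cylinder_neighbourhood:
  assumes "openin (path_space \<Lambda>) T" "y \<in> T"
  obtains N where "y \<in> infinite_paths \<Lambda>" "\<And>m. N \<le> m \<Longrightarrow> cylinder \<Lambda> (y 0 m) \<subseteq> T"
proof -
  have y: "y \<in> infinite_paths \<Lambda>"
    using assms openin_subset topspace_path_space by blast
  have "generate_topology_on (cylinder \<Lambda> ` Mor \<Lambda>) T"
    using assms(1) unfolding path_space_def by (rule openin_topology_generated_by)
  then have "y \<in> T \<Longrightarrow> \<exists>N. \<forall>m. N \<le> m \<longrightarrow> cylinder \<Lambda> (y 0 m) \<subseteq> T"
  proof (induction rule: generate_topology_on.induct)
    case (Int a b)
    then obtain N N' where N: "\<forall>m. N \<le> m \<longrightarrow> cylinder \<Lambda> (y 0 m) \<subseteq> a"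
      "\<forall>m. N' \<le> m \<longrightarrow> cylinder \<Lambda> (y 0 m) \<subseteq> b" by blast
    have "cylinder \<Lambda> (y 0 m) \<subseteq> a \<inter> b" if "N + N' \<le> m" for m
    proof -
      have "N \<le> m" "N' \<le> m"
        using that le_add_degree order_trans by metis+
      then show ?thesis
        using N by blast
    qed
    then show ?case by blast
  next
    case (Basis s)
    then obtain \<mu> where \<mu>: "\<mu> \<in> Mor \<Lambda>" "s = cylinder \<Lambda> \<mu>" "y 0 (deg \<Lambda> \<mu>) = \<mu>"
      by (auto simp: cylinder_eq)
    have "cylinder \<Lambda> (y 0 m) \<subseteq> s" if "deg \<Lambda> \<mu> \<le> m" for m
    proof
      fix z assume "z \<in> cylinder \<Lambda> (y 0 m)"
      then have z: "z \<in> infinite_paths \<Lambda>" "z 0 m = y 0 m"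
        using y by (auto simp: cylinder_eq ipath_initial)
      then have "z 0 (deg \<Lambda> \<mu>) = y 0 (deg \<Lambda> \<mu>)"
        using ipath_prefix[OF z(1) that] ipath_prefix[OF y that] is_prefix_unique ipath_initial(2) y
        by metis
      then show "z \<in> s"
        using z \<mu> by (auto simp: cylinder_eq)
    qed
    then show ?case by blast
  qed blast+
  then show ?thesis
    using that y assms(2) by blast
qed

end


section \<open>Tails of infinite paths\<close>

context k_graph
begin

definition reaches :: "'l \<Rightarrow> 'l \<Rightarrow> bool" where
  "reaches v w \<longleftrightarrow> paths_into \<Lambda> v {w} \<noteq> {}"

lemma reaches_iff: "reaches v w \<longleftrightarrow> (\<exists>\<mu> \<in> Mor \<Lambda>. rng \<Lambda> \<mu> = v \<and> src \<Lambda> \<mu> = w)"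
  by (auto simp: reaches_def paths_into_def)

lemma reaches_refl: "v \<in> vertices \<Lambda> \<Longrightarrow> reaches v v"
  using vertex_rng_src[of v] by (auto simp: reaches_iff)

lemma reaches_trans: "\<lbrakk>reaches u v; reaches v w\<rbrakk> \<Longrightarrow> reaches u w"
  unfolding reaches_iff by (metis cmp_closed rng_cmp src_cmp)

lemma reaches_ipath: "\<lbrakk>x \<in> infinite_paths \<Lambda>; n \<le> m\<rbrakk> \<Longrightarrow> reaches (x n n) (x m m)"
  unfolding reaches_iff using ipath_morphism by metis

end

context self_similar_k_graph
begin

lemma group_G: "group G"
  using group_hom by (simp add: group_hom_def)

sublocale G: group G
  by (rule group_G)

lemma act_one: "\<mu> \<in> Mor \<Lambda> \<Longrightarrow> act \<one> \<mu> = \<mu>"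
  using id_eq_one by (metis restrict_apply')

lemma act_closed: "\<lbrakk>g \<in> carrier G; \<mu> \<in> Mor \<Lambda>\<rbrakk> \<Longrightarrow> act g \<mu> \<in> Mor \<Lambda>"
  using surj_prop by blast

lemma act_vertex: "\<lbrakk>g \<in> carrier G; v \<in> vertices \<Lambda>\<rbrakk> \<Longrightarrow> act g v \<in> vertices \<Lambda>"
  by (auto simp: vertices_def act_closed deg_act)

lemma res_one: "\<mu> \<in> Mor \<Lambda> \<Longrightarrow> res \<one> \<mu> = \<one>"
proof -
  assume \<mu>: "\<mu> \<in> Mor \<Lambda>"
  then have "res \<one> \<mu> = res \<one> \<mu> \<otimes> res \<one> \<mu>"
    using res_mult[of \<one> \<one> \<mu>] act_one by simp
  then show ?thesis
    using \<mu> res_closed G.l_cancel_one' by simp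
qed

lemma reaches_act: "\<lbrakk>g \<in> carrier G; reaches v w\<rbrakk> \<Longrightarrow> reaches (act g v) (act g w)"
  unfolding reaches_iff using act_closed rng_act src_act by metis

lemma act_ipath_segment: "n \<le> m \<Longrightarrow> act_ipath act res g x n m = act (res g (x 0 n)) (x n m)"
  by (simp add: act_ipath_def)

lemma act_ipath_initial:
  assumes "g \<in> carrier G" "x \<in> infinite_paths \<Lambda>"
  shows "act_ipath act res g x 0 n = act g (x 0 n)"
  using assms ipath_vertex[of x 0] by (simp add: act_ipath_segment res_vertex)

lemma ip_rng_act_ipath:
  assumes "g \<in> carrier G" "x \<in> infinite_paths \<Lambda>"
  shows "ip_rng (act_ipath act res g x) = act g (ip_rng x)"
  using act_ipath_initial[OF assms, of 0] by (simp add: ip_rng_def)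

lemma act_ipath_closed:
  assumes g: "g \<in> carrier G" and x: "x \<in> infinite_paths \<Lambda>"
  shows "act_ipath act res g x \<in> infinite_paths \<Lambda>"
proof -
  let ?h = "\<lambda>n. res g (x 0 n)"
  have h: "?h n \<in> carrier G" for n
    by (simp add: res_closed g x ipath_initial)
  have h_res: "res (?h n) (x n m) = ?h m" if "n \<le> m" for n m
    using that res_cmp[OF g, of "x 0 n" "x n m"] by (simp add: x ipath_initial ipath_morphism ipath_cmp)
  \<comment> \<open>A vertex can be moved by the restriction to any earlier initial segment, because restriction
    is compatible with composition; this makes the translated morphisms composable.\<close>
  have h_src: "act (?h n) (x m m) = act (?h m) (x m m)" if "n \<le> m" for n m
    using act_composable[OF h, of "x n m" "x m m" n] that
    by (simp add: x h ipath_morphism rng_act src_act h_res)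
  show ?thesis
    unfolding infinite_paths_def
  proof (intro CollectI conjI allI impI)
    fix p q :: "'k \<Rightarrow> nat" assume pq: "p \<le> q"
    then show "act_ipath act res g x p q \<in> Mor \<Lambda>"
      "deg \<Lambda> (act_ipath act res g x p q) = q - p"
      "rng \<Lambda> (act_ipath act res g x p q) = act_ipath act res g x p p"
      "src \<Lambda> (act_ipath act res g x p q) = act_ipath act res g x q q"
      by (simp_all add: act_ipath_segment act_closed deg_act rng_act src_act h x ipath_morphism h_src[OF pq])
  next
    fix p q t :: "'k \<Rightarrow> nat" assume "p \<le> q \<and> q \<le> t"
    then have pq: "p \<le> q" and qt: "q \<le> t" and pt: "p \<le> t"
      by auto
    show "cmp \<Lambda> (act_ipath act res g x p q) (act_ipath act res g x q t) = act_ipath act res g x p t"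
      using act_cmp[OF h, of "x p q" "x q t" p] pq qt pt
      by (simp add: act_ipath_segment x ipath_morphism ipath_cmp h_res)
  qed (simp add: act_ipath_def)
qed

lemma act_concat_path:
  assumes g: "g \<in> carrier G" and \<mu>: "\<mu> \<in> Mor \<Lambda>" and x: "x \<in> infinite_paths \<Lambda>" "src \<Lambda> \<mu> = ip_rng x"
  shows "src \<Lambda> (act g \<mu>) = ip_rng (act_ipath act res (res g \<mu>) x)"
    and "act_ipath act res g (concat_path \<Lambda> \<mu> x) =
      concat_path \<Lambda> (act g \<mu>) (act_ipath act res (res g \<mu>) x)"
proof -
  have res: "res g \<mu> \<in> carrier G"
    by (rule res_closed[OF g \<mu>])
  have "src \<Lambda> (act g \<mu>) = rng \<Lambda> (act (res g \<mu>) (x 0 0))"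
    using act_composable[OF g \<mu>, of "x 0 0"] x by (simp add: ipath_initial)
  then show sr: "src \<Lambda> (act g \<mu>) = ip_rng (act_ipath act res (res g \<mu>) x)"
    using res x by (simp add: ip_rng_act_ipath rng_act ipath_initial)
  have y: "act_ipath act res (res g \<mu>) x \<in> infinite_paths \<Lambda>"
    by (rule act_ipath_closed[OF res x(1)])
  have \<mu>x: "concat_path \<Lambda> \<mu> x \<in> infinite_paths \<Lambda>"
    by (rule concat_path_closed[OF \<mu> x])
  show "act_ipath act res g (concat_path \<Lambda> \<mu> x) =
      concat_path \<Lambda> (act g \<mu>) (act_ipath act res (res g \<mu>) x)"
  proof (rule ipath_eqI[of _ _ "deg \<Lambda> \<mu>"])
    fix n
    have "concat_path \<Lambda> (act g \<mu>) (act_ipath act res (res g \<mu>) x) 0 (deg \<Lambda> \<mu> + n) =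
        cmp \<Lambda> (act g \<mu>) (act (res g \<mu>) (x 0 n))"
      using concat_path_segment[OF act_closed[OF g \<mu>] y sr, of n]
      by (simp add: deg_act g \<mu> act_ipath_initial res x)
    also have "\<dots> = act g (cmp \<Lambda> \<mu> (x 0 n))"
      by (rule act_cmp[symmetric]) (use g \<mu> x in \<open>simp_all add: ipath_initial\<close>)
    also have "\<dots> = act_ipath act res g (concat_path \<Lambda> \<mu> x) 0 (deg \<Lambda> \<mu> + n)"
      by (simp add: act_ipath_initial g \<mu>x concat_path_segment \<mu> x)
    finally show "act_ipath act res g (concat_path \<Lambda> \<mu> x) 0 (deg \<Lambda> \<mu> + n) =
        concat_path \<Lambda> (act g \<mu>) (act_ipath act res (res g \<mu>) x) 0 (deg \<Lambda> \<mu> + n)"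
      by simp
  qed (use g \<mu> y sr \<mu>x in \<open>auto intro: act_ipath_closed concat_path_closed act_closed\<close>)
qed

text \<open>The maximal tail that describes the closure of the orbit of \<open>x\<close>.\<close>

definition tail_of :: "('l, 'k) ipath \<Rightarrow> 'l set" where
  "tail_of x = {v \<in> vertices \<Lambda>. \<exists>n. \<exists>g \<in> carrier G. reaches v (act g (x n n))}"

lemma maximal_tails_iff:
  "M \<in> maximal_tails G \<Lambda> act \<longleftrightarrow> M \<subseteq> vertices \<Lambda> \<and> M \<noteq> {} \<and>
    (\<forall>g \<in> carrier G. \<forall>v \<in> M. act g v \<in> M) \<and>
    (\<forall>v \<in> vertices \<Lambda>. \<forall>w \<in> M. reaches v w \<longrightarrow> v \<in> M) \<and>
    (\<forall>v \<in> M. \<forall>i. \<exists>\<mu> \<in> paths_into \<Lambda> v M. deg \<Lambda> \<mu> = (\<lambda>j. if j = i then 1 else 0)) \<and>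
    (\<forall>v \<in> M. \<forall>w \<in> M. \<exists>g \<in> carrier G. \<exists>u \<in> M. reaches v u \<and> reaches w (act g u))"
  by (simp add: maximal_tails_def reaches_def)

lemma vertex_in_tail_of: "x \<in> infinite_paths \<Lambda> \<Longrightarrow> x n n \<in> tail_of x"
  unfolding tail_of_def using ipath_vertex[of x n] reaches_refl[of "x n n"] act_one[of "x n n"]
  by (auto simp: vertices_def intro!: exI[of _ n] bexI[of _ \<one>])

lemma tail_of_hereditary: "\<lbrakk>v \<in> vertices \<Lambda>; w \<in> tail_of x; reaches v w\<rbrakk> \<Longrightarrow> v \<in> tail_of x"
  unfolding tail_of_def using reaches_trans by blast

lemma tail_of_invariant:
  assumes "x \<in> infinite_paths \<Lambda>" "h \<in> carrier G" "v \<in> tail_of x"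
  shows "act h v \<in> tail_of x"
proof -
  obtain n g where g: "v \<in> vertices \<Lambda>" "g \<in> carrier G" "reaches v (act g (x n n))"
    using assms by (auto simp: tail_of_def)
  then have "reaches (act h v) (act (h \<otimes> g) (x n n))"
    using assms reaches_act[of h v] composition_rule[of "x n n" h g] by (simp add: ipath_morphism)
  then show ?thesis
    using g assms act_vertex unfolding tail_of_def by blast
qed

text \<open>
  Any two vertices of the tail of \<open>x\<close> reach translates of a common \<open>x(n)\<close>, which gives the last
  condition on a maximal tail; translating the path from \<open>x(n)\<close> to \<open>x(n + e\<^sub>i)\<close> gives edges of every
  colour.
\<close>

lemma tail_of_maximal:
  assumes x: "x \<in> infinite_paths \<Lambda>"
  shows "tail_of x \<in> maximal_tails G \<Lambda> act"
  unfolding maximal_tails_iff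
proof (intro conjI ballI allI impI)
  show "tail_of x \<subseteq> vertices \<Lambda>"
    by (auto simp: tail_of_def)
  show "tail_of x \<noteq> {}"
    using vertex_in_tail_of[OF x] by blast
next
  fix v and i :: 'k
  assume "v \<in> tail_of x"
  then obtain n g \<kappa> where g: "g \<in> carrier G"
    and \<kappa>: "\<kappa> \<in> Mor \<Lambda>" "rng \<Lambda> \<kappa> = v" "src \<Lambda> \<kappa> = act g (x n n)"
    by (auto simp: tail_of_def reaches_iff)
  define e :: "'k \<Rightarrow> nat" where "e = (\<lambda>j. if j = i then 1 else 0)"
  define \<eta> where "\<eta> = act g (x n (n + e))"
  have \<eta>: "\<eta> \<in> Mor \<Lambda>" "rng \<Lambda> \<eta> = act g (x n n)" "src \<Lambda> \<eta> = act g (x (n + e) (n + e))" "deg \<Lambda> \<eta> = e"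
    by (auto simp: \<eta>_def g x ipath_morphism act_closed rng_act src_act deg_act)
  have "e \<le> deg \<Lambda> (cmp \<Lambda> \<kappa> \<eta>)"
    using \<kappa> \<eta> by (simp add: deg_cmp)
  then obtain \<alpha> \<beta> where \<alpha>\<beta>: "\<alpha> \<in> Mor \<Lambda>" "\<beta> \<in> Mor \<Lambda>" "src \<Lambda> \<alpha> = rng \<Lambda> \<beta>" "deg \<Lambda> \<alpha> = e"
    "cmp \<Lambda> \<kappa> \<eta> = cmp \<Lambda> \<alpha> \<beta>"
    using obtain_factor[of "cmp \<Lambda> \<kappa> \<eta>" e] \<kappa> \<eta> cmp_closed by metis
  have "rng \<Lambda> \<alpha> = v" "src \<Lambda> \<beta> = src \<Lambda> \<eta>"
    using \<kappa> \<eta> \<alpha>\<beta> by (metis rng_cmp, metis src_cmp)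
  moreover have "act g (x (n + e) (n + e)) \<in> tail_of x"
    by (rule tail_of_invariant[OF x g vertex_in_tail_of[OF x]])
  moreover have "reaches (src \<Lambda> \<alpha>) (src \<Lambda> \<beta>)"
    using \<alpha>\<beta> unfolding reaches_iff by metis
  ultimately have "src \<Lambda> \<alpha> \<in> tail_of x"
    using tail_of_hereditary \<alpha>\<beta> \<eta> src_in_vertices by metis
  then show "\<exists>\<mu> \<in> paths_into \<Lambda> v (tail_of x). deg \<Lambda> \<mu> = (\<lambda>j. if j = i then 1 else 0)"
    using \<alpha>\<beta> \<open>rng \<Lambda> \<alpha> = v\<close> by (auto simp: paths_into_def e_def)
next
  fix v w assume "v \<in> tail_of x" "w \<in> tail_of x"
  then obtain n g m h where g: "g \<in> carrier G" "reaches v (act g (x n n))"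
    and h: "h \<in> carrier G" "reaches w (act h (x m m))"
    by (auto simp: tail_of_def)
  let ?z = "x (n + m) (n + m)"
  have z: "?z \<in> Mor \<Lambda>"
    using x by (simp add: ipath_morphism)
  have "reaches v (act g ?z)" "reaches w (act h ?z)"
    using g h reaches_ipath[OF x, of _ "n + m"] reaches_act reaches_trans le_add_degree by metis+
  moreover have "act (h \<otimes> inv g) (act g ?z) = act h ?z"
  proof -
    have "act (h \<otimes> inv g) (act g ?z) = act ((h \<otimes> inv g) \<otimes> g) ?z"
      by (rule composition_rule[symmetric]) (use g h z in auto)
    also have "(h \<otimes> inv g) \<otimes> g = h"
      using g h by (simp add: G.m_assoc)
    finally show ?thesis .
  qed
  moreover have "act g ?z \<in> tail_of x"
    using tail_of_invariant[OF x g(1)] vertex_in_tail_of[OF x] by blast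
  moreover have "h \<otimes> inv g \<in> carrier G"
    using g h by simp
  ultimately show "\<exists>g \<in> carrier G. \<exists>u \<in> tail_of x. reaches v u \<and> reaches w (act g u)"
    by metis
qed (use x tail_of_invariant tail_of_hereditary in blast)+

lemma maximal_tail_unbounded_path:
  assumes M: "M \<in> maximal_tails G \<Lambda> act" and v: "v \<in> M"
  obtains \<mu> where "\<mu> \<in> paths_into \<Lambda> v M" "1 \<le> deg \<Lambda> \<mu>"
proof -
  have "\<exists>\<mu> \<in> paths_into \<Lambda> v M. \<forall>i \<in> I. 1 \<le> deg \<Lambda> \<mu> i" if "finite I" for I :: "'k set"
    using that
  proof (induction I)
    case empty
    have "v \<in> paths_into \<Lambda> v M"
      using M v vertex_rng_src[of v] by (auto simp: maximal_tails_iff paths_into_def)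
    then show ?case by blast
  next
    case (insert i I)
    then obtain \<mu> where \<mu>: "\<mu> \<in> Mor \<Lambda>" "rng \<Lambda> \<mu> = v" "src \<Lambda> \<mu> \<in> M" "\<forall>i \<in> I. 1 \<le> deg \<Lambda> \<mu> i"
      by (auto simp: paths_into_def)
    then obtain \<nu> where \<nu>: "\<nu> \<in> Mor \<Lambda>" "rng \<Lambda> \<nu> = src \<Lambda> \<mu>" "src \<Lambda> \<nu> \<in> M"
      "deg \<Lambda> \<nu> = (\<lambda>j. if j = i then 1 else 0)"
      using M unfolding maximal_tails_iff paths_into_def by blast
    have "cmp \<Lambda> \<mu> \<nu> \<in> paths_into \<Lambda> v M" "deg \<Lambda> (cmp \<Lambda> \<mu> \<nu>) = deg \<Lambda> \<mu> + deg \<Lambda> \<nu>"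
      using \<mu> \<nu> by (auto simp: paths_into_def cmp_closed rng_cmp src_cmp deg_cmp)
    then show ?case
      using \<mu> \<nu> by (intro bexI[of _ "cmp \<Lambda> \<mu> \<nu>"]) auto
  qed
  from this[of UNIV] show ?thesis
    using that by (auto simp: le_fun_def)
qed

text \<open>
  Every maximal tail is the tail of an infinite path, which may moreover start with any given
  path into the tail.  Enumerate the tail; extend a given initial segment repeatedly inside the
  tail so that the end of the \<open>n\<close>th extension, up to translation, is reached by the \<open>n\<close>th vertex
  (the last condition on maximal tails) and all coordinates of the degree grow.
\<close>

lemma maximal_tail_eq_tail_of:
  assumes countable: "countable (Mor \<Lambda>)" and M: "M \<in> maximal_tails G \<Lambda> act"
    and \<kappa>: "\<kappa> \<in> Mor \<Lambda>" "src \<Lambda> \<kappa> \<in> M"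
  obtains x where "x \<in> infinite_paths \<Lambda>" "x 0 (deg \<Lambda> \<kappa>) = \<kappa>" "tail_of x = M"
proof -
  have M_vertices: "M \<subseteq> vertices \<Lambda>" and M_nonempty: "M \<noteq> {}"
    and M_act: "\<And>g v. \<lbrakk>g \<in> carrier G; v \<in> M\<rbrakk> \<Longrightarrow> act g v \<in> M"
    and M_hereditary: "\<And>v w. \<lbrakk>v \<in> vertices \<Lambda>; w \<in> M; reaches v w\<rbrakk> \<Longrightarrow> v \<in> M"
    and M_directed: "\<And>v w. \<lbrakk>v \<in> M; w \<in> M\<rbrakk> \<Longrightarrow> \<exists>g \<in> carrier G. \<exists>u \<in> M. reaches v u \<and> reaches w (act g u)"
    using M unfolding maximal_tails_iff by blast+
  define enum where "enum = from_nat_into M"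
  have M_range: "range enum = M"
    unfolding enum_def using M_nonempty M_vertices countable
    by (intro range_from_nat_into) (auto simp: vertices_def intro: countable_subset)
  define step where "step n \<rho> \<rho>' \<longleftrightarrow> is_prefix \<rho> \<rho>' \<and> deg \<Lambda> \<rho> + 1 \<le> deg \<Lambda> \<rho>' \<and>
      (\<exists>g \<in> carrier G. reaches (enum n) (act g (src \<Lambda> \<rho>')))" for n \<rho> \<rho>'
  have extend: "\<exists>\<rho>'. (\<rho>' \<in> Mor \<Lambda> \<and> src \<Lambda> \<rho>' \<in> M) \<and> step n \<rho> \<rho>'"
    if \<rho>: "\<rho> \<in> Mor \<Lambda> \<and> src \<Lambda> \<rho> \<in> M" for \<rho> n
  proof -
    obtain \<mu> where \<mu>: "\<mu> \<in> Mor \<Lambda>" "rng \<Lambda> \<mu> = src \<Lambda> \<rho>" "src \<Lambda> \<mu> \<in> M" "1 \<le> deg \<Lambda> \<mu>"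
      using maximal_tail_unbounded_path[OF M] \<rho> by (auto simp: paths_into_def)
    obtain g u \<nu> where g: "g \<in> carrier G" "u \<in> M" "reaches (enum n) (act g u)"
      and \<nu>: "\<nu> \<in> Mor \<Lambda>" "rng \<Lambda> \<nu> = src \<Lambda> \<mu>" "src \<Lambda> \<nu> = u"
      using M_directed[OF \<mu>(3), of "enum n"] M_range by (auto simp: reaches_iff)
    have \<mu>\<nu>: "cmp \<Lambda> \<mu> \<nu> \<in> Mor \<Lambda>" "rng \<Lambda> (cmp \<Lambda> \<mu> \<nu>) = src \<Lambda> \<rho>" "src \<Lambda> (cmp \<Lambda> \<mu> \<nu>) = u"
      "1 \<le> deg \<Lambda> (cmp \<Lambda> \<mu> \<nu>)"
      using \<mu> \<nu> by (auto simp: cmp_closed rng_cmp src_cmp deg_cmp le_fun_def intro: trans_le_add1)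
    show ?thesis
      using \<rho> \<mu>\<nu> g is_prefix_cmp[of \<rho> "cmp \<Lambda> \<mu> \<nu>"] unfolding step_def
      by (intro exI[of _ "cmp \<Lambda> \<rho> (cmp \<Lambda> \<mu> \<nu>)"]) (auto simp: cmp_closed src_cmp deg_cmp)
  qed
  have "\<exists>\<rho>. \<forall>n. ((\<rho> n \<in> Mor \<Lambda> \<and> src \<Lambda> (\<rho> n) \<in> M) \<and> (n = 0 \<longrightarrow> \<rho> n = \<kappa>)) \<and>
      step n (\<rho> n) (\<rho> (Suc n))"
  proof (rule dependent_nat_choice)
    show "\<exists>\<rho>. (\<rho> \<in> Mor \<Lambda> \<and> src \<Lambda> \<rho> \<in> M) \<and> (0 = (0::nat) \<longrightarrow> \<rho> = \<kappa>)"
      using \<kappa> by blast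
  qed (use extend in blast)
  then obtain \<rho> where \<rho>0: "\<rho> 0 = \<kappa>" and \<rho>: "\<And>n. \<rho> n \<in> Mor \<Lambda> \<and> src \<Lambda> (\<rho> n) \<in> M"
    and step: "\<And>n. is_prefix (\<rho> n) (\<rho> (Suc n))" "\<And>n. deg \<Lambda> (\<rho> n) + 1 \<le> deg \<Lambda> (\<rho> (Suc n))"
      "\<And>n. \<exists>g \<in> carrier G. reaches (enum n) (act g (src \<Lambda> (\<rho> (Suc n))))"
    unfolding step_def by blast
  have mono: "is_prefix (\<rho> n) (\<rho> m)" if "n \<le> m" for n m
    using that
  proof (induction m rule: dec_induct)
    case base
    then show ?case using \<rho> is_prefix_refl by blast
  next
    case (step m)
    then show ?case using \<open>\<And>n. is_prefix (\<rho> n) (\<rho> (Suc n))\<close> is_prefix_trans by blast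
  qed
  have deg_ge: "n \<le> deg \<Lambda> (\<rho> n) i" for n i
  proof (induction n)
    case (Suc n)
    then show ?case
      using step(2)[of n] by (fastforce simp: le_fun_def dest: spec[of _ i])
  qed simp
  have directed: "\<forall>\<alpha> \<in> range \<rho>. \<forall>\<beta> \<in> range \<rho>. \<exists>\<gamma> \<in> range \<rho>. is_prefix \<alpha> \<gamma> \<and> is_prefix \<beta> \<gamma>"
    using mono max.cobounded1 max.cobounded2 by blast
  have cofinal: "\<forall>p. \<exists>\<alpha> \<in> range \<rho>. p \<le> deg \<Lambda> \<alpha>"
  proof
    fix p :: "'k \<Rightarrow> nat"
    have "p \<le> deg \<Lambda> (\<rho> (\<Sum>i \<in> UNIV. p i))"
      unfolding le_fun_def
      by (intro allI order_trans[OF member_le_sum deg_ge]) auto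
    then show "\<exists>\<alpha> \<in> range \<rho>. p \<le> deg \<Lambda> \<alpha>" by blast
  qed
  obtain x where x: "x \<in> infinite_paths \<Lambda>" "\<forall>\<alpha> \<in> range \<rho>. x 0 (deg \<Lambda> \<alpha>) = \<alpha>"
    using ipath_of_directed[OF directed cofinal] by blast
  have x_\<rho>: "x (deg \<Lambda> (\<rho> n)) (deg \<Lambda> (\<rho> n)) = src \<Lambda> (\<rho> n)" for n
    using ipath_initial(4)[OF x(1), of "deg \<Lambda> (\<rho> n)"] x(2) by simp
  have x_M: "x p p \<in> M" for p
  proof -
    obtain n where n: "p \<le> deg \<Lambda> (\<rho> n)"
      using cofinal by blast
    then have "reaches (x p p) (src \<Lambda> (\<rho> n))"
      using reaches_ipath[OF x(1) n] x_\<rho> by simp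
    then show ?thesis
      using M_hereditary \<rho> ipath_vertex[OF x(1)] by blast
  qed
  have "tail_of x \<subseteq> M"
    unfolding tail_of_def using x_M M_act M_hereditary by blast
  moreover have "M \<subseteq> tail_of x"
  proof
    fix v assume "v \<in> M"
    then obtain n where "v = enum n"
      using M_range by blast
    then obtain g where "g \<in> carrier G"
      "reaches v (act g (x (deg \<Lambda> (\<rho> (Suc n))) (deg \<Lambda> (\<rho> (Suc n)))))"
      using step(3)[of n] x_\<rho>[of "Suc n"] by auto
    then show "v \<in> tail_of x"
      unfolding tail_of_def using \<open>v \<in> M\<close> M_vertices by blast
  qed
  ultimately show ?thesis
    using that x(1) x(2) \<rho>0 by (metis rangeI subset_antisym)
qed

end


section \<open>Arrows and their neighbourhoods\<close>

lemma iso_interior_iff: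
  "a \<in> iso_interior \<G> F \<longleftrightarrow> (\<exists>T. openin (arrow_top \<G>) T \<and> a \<in> T \<and> gpd_rng \<G> a \<in> F \<and>
    (\<forall>b \<in> T. gpd_rng \<G> b \<in> F \<longrightarrow> gpd_rng \<G> b = gpd_src \<G> b))"
proof -
  have "a \<in> iso_interior \<G> F \<longleftrightarrow> (\<exists>T. openin (arrow_top \<G>) T \<and>
      a \<in> T \<inter> {a \<in> topspace (arrow_top \<G>). gpd_rng \<G> a \<in> F} \<and>
      T \<inter> {a \<in> topspace (arrow_top \<G>). gpd_rng \<G> a \<in> F} \<subseteq>
        {a \<in> topspace (reduction_top \<G> F). gpd_rng \<G> a = gpd_src \<G> a})"
    unfolding iso_interior_def interior_of_def reduction_top_def openin_subtopology by blast
  also have "\<dots> \<longleftrightarrow> (\<exists>T. openin (arrow_top \<G>) T \<and> a \<in> T \<and> gpd_rng \<G> a \<in> F \<and>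
      (\<forall>b \<in> T. gpd_rng \<G> b \<in> F \<longrightarrow> gpd_rng \<G> b = gpd_src \<G> b))"
    by (rule ex_cong1) (auto simp: reduction_top_def dest: openin_subset)
  finally show ?thesis .
qed

context self_similar_k_graph
begin

abbreviation EP :: "(('l, 'k) ipath, ('g, 'l, 'k) ep_arrow) top_groupoid" where
  "EP \<equiv> exel_pardo_groupoid G \<Lambda> act res"

text \<open>
  One arrow has many representations by a quadruple \<open>(\<mu>, g, \<nu>, z)\<close>: \<open>ep_data\<close> says that a quadruple
  represents an arrow, and \<open>ep_germ\<close> is the arrow that it represents.
\<close>

definition ep_data :: "'l \<Rightarrow> 'g \<Rightarrow> 'l \<Rightarrow> ('l, 'k) ipath \<Rightarrow> bool" where
  "ep_data \<mu> g \<nu> z \<longleftrightarrow> \<mu> \<in> Mor \<Lambda> \<and> g \<in> carrier G \<and> \<nu> \<in> Mor \<Lambda> \<and> z \<in> infinite_paths \<Lambda> \<and>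
    src \<Lambda> \<nu> = ip_rng z \<and> src \<Lambda> \<mu> = act g (ip_rng z)"

definition ep_germ :: "'l \<Rightarrow> 'g \<Rightarrow> 'l \<Rightarrow> ('l, 'k) ipath \<Rightarrow> ('g, 'l, 'k) ep_arrow" where
  "ep_germ \<mu> g \<nu> z =
    (concat_path \<Lambda> \<mu> (act_ipath act res g z), Q_shift G (deg_int \<Lambda> \<mu>) (res_ipath G res g z),
     deg_int \<Lambda> \<mu> - deg_int \<Lambda> \<nu>, concat_path \<Lambda> \<nu> z)"

lemma ep_basic_eq:
  assumes "\<mu> \<in> Mor \<Lambda>" "g \<in> carrier G" "\<nu> \<in> Mor \<Lambda>"
  shows "ep_basic G \<Lambda> act res \<mu> g \<nu> = {ep_germ \<mu> g \<nu> z | z. ep_data \<mu> g \<nu> z}"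
  unfolding ep_basic_def ep_data_def ep_germ_def using assms by blast

lemma ep_basic_open:
  assumes "\<mu> \<in> Mor \<Lambda>" "g \<in> carrier G" "\<nu> \<in> Mor \<Lambda>"
  shows "openin (arrow_top EP) (ep_basic G \<Lambda> act res \<mu> g \<nu>)"
proof -
  have "ep_basic G \<Lambda> act res \<mu> g \<nu> \<in>
      {ep_basic G \<Lambda> act res \<mu> g \<nu> | \<mu> g \<nu>. \<mu> \<in> Mor \<Lambda> \<and> g \<in> carrier G \<and> \<nu> \<in> Mor \<Lambda>}"
    using assms by blast
  from topology_generated_by_Basis[OF this] show ?thesis
    by (simp add: exel_pardo_groupoid_def)
qed

lemma arrows_iff: "a \<in> topspace (arrow_top EP) \<longleftrightarrow> (\<exists>\<mu> g \<nu> z. ep_data \<mu> g \<nu> z \<and> a = ep_germ \<mu> g \<nu> z)"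
proof -
  have "a \<in> topspace (arrow_top EP) \<longleftrightarrow>
      (\<exists>\<mu> g \<nu>. \<mu> \<in> Mor \<Lambda> \<and> g \<in> carrier G \<and> \<nu> \<in> Mor \<Lambda> \<and> a \<in> ep_basic G \<Lambda> act res \<mu> g \<nu>)"
    unfolding exel_pardo_groupoid_def by (simp add: Bex_def) blast
  also have "\<dots> \<longleftrightarrow> (\<exists>\<mu> g \<nu> z. ep_data \<mu> g \<nu> z \<and> a = ep_germ \<mu> g \<nu> z)"
  proof
    assume "\<exists>\<mu> g \<nu>. \<mu> \<in> Mor \<Lambda> \<and> g \<in> carrier G \<and> \<nu> \<in> Mor \<Lambda> \<and> a \<in> ep_basic G \<Lambda> act res \<mu> g \<nu>"
    then show "\<exists>\<mu> g \<nu> z. ep_data \<mu> g \<nu> z \<and> a = ep_germ \<mu> g \<nu> z"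
      using ep_basic_eq by fast
  next
    assume "\<exists>\<mu> g \<nu> z. ep_data \<mu> g \<nu> z \<and> a = ep_germ \<mu> g \<nu> z"
    then obtain \<mu> g \<nu> z where z: "ep_data \<mu> g \<nu> z" "a = ep_germ \<mu> g \<nu> z"
      by blast
    then have data: "\<mu> \<in> Mor \<Lambda>" "g \<in> carrier G" "\<nu> \<in> Mor \<Lambda>"
      by (simp_all add: ep_data_def)
    then have "a \<in> ep_basic G \<Lambda> act res \<mu> g \<nu>"
      using ep_basic_eq z by blast
    then show "\<exists>\<mu> g \<nu>. \<mu> \<in> Mor \<Lambda> \<and> g \<in> carrier G \<and> \<nu> \<in> Mor \<Lambda> \<and> a \<in> ep_basic G \<Lambda> act res \<mu> g \<nu>"
      using data by blast
  qed
  finally show ?thesis .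
qed

lemma germ_ends [simp]:
  "gpd_rng EP (ep_germ \<mu> g \<nu> z) = concat_path \<Lambda> \<mu> (act_ipath act res g z)"
  "gpd_src EP (ep_germ \<mu> g \<nu> z) = concat_path \<Lambda> \<nu> z"
  "standard_grading (ep_germ \<mu> g \<nu> z) = deg_int \<Lambda> \<mu> - deg_int \<Lambda> \<nu>"
  by (simp_all add: exel_pardo_groupoid_def ep_germ_def standard_grading_def)

lemma unit_top_EP: "unit_top EP = path_space \<Lambda>"
  by (simp add: exel_pardo_groupoid_def)

lemma ep_dataD:
  assumes "ep_data \<mu> g \<nu> z"
  shows "\<mu> \<in> Mor \<Lambda>" "g \<in> carrier G" "\<nu> \<in> Mor \<Lambda>" "z \<in> infinite_paths \<Lambda>" "src \<Lambda> \<nu> = ip_rng z"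
    "act_ipath act res g z \<in> infinite_paths \<Lambda>" "src \<Lambda> \<mu> = ip_rng (act_ipath act res g z)"
  using assms by (auto simp: ep_data_def act_ipath_closed ip_rng_act_ipath)

lemma tail_class_eq_iff:
  fixes f f' :: "('k \<Rightarrow> nat) \<Rightarrow> 'g"
  assumes "range f \<subseteq> carrier G"
  shows "tail_class G f = tail_class G f' \<longleftrightarrow> (\<exists>m. \<forall>n. m \<le> n \<longrightarrow> f n = f' n)"
proof
  assume "tail_class G f = tail_class G f'"
  moreover have "f \<in> tail_class G f"
    using assms by (auto simp: tail_class_def)
  ultimately show "\<exists>m. \<forall>n. m \<le> n \<longrightarrow> f n = f' n"
    by (auto simp: tail_class_def)
next
  have *: "tail_class G p \<subseteq> tail_class G q" if m: "\<forall>n. m \<le> n \<longrightarrow> p n = q n"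
    for p q :: "('k \<Rightarrow> nat) \<Rightarrow> 'g" and m
  proof
    fix h assume "h \<in> tail_class G p"
    then obtain m' where h: "range h \<subseteq> carrier G" "\<forall>n. m' \<le> n \<longrightarrow> h n = p n"
      by (auto simp: tail_class_def)
    then have "\<forall>n. m + m' \<le> n \<longrightarrow> h n = q n"
      using m by (metis le_add_degree order_trans)
    then show "h \<in> tail_class G q"
      using h by (auto simp: tail_class_def)
  qed
  assume "\<exists>m. \<forall>n. m \<le> n \<longrightarrow> f n = f' n"
  then obtain m where "\<forall>n. m \<le> n \<longrightarrow> f n = f' n"
    by blast
  then show "tail_class G f = tail_class G f'"
    using *[of m f f'] *[of m f' f] by auto
qed

text \<open>
  The shifted class is represented by the shift of any representative, so that equality of the
  group components of two arrows is an eventual equality of functions.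
\<close>

lemma Q_shift_res:
  assumes g: "g \<in> carrier G" and z: "z \<in> infinite_paths \<Lambda>"
  shows "Q_shift G (deg_int \<Lambda> \<mu>) (res_ipath G res g z) =
    tail_class G (\<lambda>n. if deg \<Lambda> \<mu> \<le> n then res g (z 0 (n - deg \<Lambda> \<mu>)) else \<one>)"
proof -
  have shift: "shift_fun G (deg_int \<Lambda> \<mu>) f = (\<lambda>n. if deg \<Lambda> \<mu> \<le> n then f (n - deg \<Lambda> \<mu>) else \<one>)"
    for f :: "('k \<Rightarrow> nat) \<Rightarrow> 'g"
  proof
    fix n :: "'k \<Rightarrow> nat"
    have "(\<lambda>i. nat (int (n i) - int (deg \<Lambda> \<mu> i))) = n - deg \<Lambda> \<mu>"
      by (auto simp: fun_eq_iff)
    then show "shift_fun G (deg_int \<Lambda> \<mu>) f n = (if deg \<Lambda> \<mu> \<le> n then f (n - deg \<Lambda> \<mu>) else \<one>)"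
      by (simp add: shift_fun_def deg_int_def le_fun_def)
  qed
  let ?f = "\<lambda>n. res g (z 0 n)"
  have f: "range ?f \<subseteq> carrier G"
    using g z by (auto simp: res_closed ipath_initial)
  have "tail_class G (shift_fun G (deg_int \<Lambda> \<mu>) f') = tail_class G (shift_fun G (deg_int \<Lambda> \<mu>) ?f)"
    if f': "f' \<in> tail_class G ?f" for f'
  proof -
    obtain m where m: "range f' \<subseteq> carrier G" "\<And>n. m \<le> n \<Longrightarrow> f' n = ?f n"
      using f' by (auto simp: tail_class_def)
    have "shift_fun G (deg_int \<Lambda> \<mu>) f' n = shift_fun G (deg_int \<Lambda> \<mu>) ?f n" if "deg \<Lambda> \<mu> + m \<le> n" for n
    proof -
      have "m \<le> n - deg \<Lambda> \<mu>"
        using that unfolding le_fun_def by (metis add.commute add_le_imp_le_diff minus_apply plus_fun_apply)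
      then show ?thesis
        using m(2) by (simp add: shift)
    qed
    moreover have "range (shift_fun G (deg_int \<Lambda> \<mu>) f') \<subseteq> carrier G"
      using m(1) by (auto simp: shift)
    ultimately show ?thesis
      using tail_class_eq_iff by blast
  qed
  moreover have "?f \<in> tail_class G ?f"
    using f by (auto simp: tail_class_def)
  ultimately have "Q_shift G (deg_int \<Lambda> \<mu>) (res_ipath G res g z) =
      tail_class G (shift_fun G (deg_int \<Lambda> \<mu>) ?f)"
    unfolding Q_shift_def res_ipath_def by blast
  then show ?thesis
    by (simp add: shift)
qed

lemma Q_shift_res_eq_iff:
  assumes "g \<in> carrier G" "z \<in> infinite_paths \<Lambda>" "h \<in> carrier G" "w \<in> infinite_paths \<Lambda>"
  shows "Q_shift G (deg_int \<Lambda> \<mu>) (res_ipath G res g z) = Q_shift G (deg_int \<Lambda> \<alpha>) (res_ipath G res h w) \<longleftrightarrow>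
    (\<exists>N. \<forall>n. N \<le> n \<longrightarrow> (if deg \<Lambda> \<mu> \<le> n then res g (z 0 (n - deg \<Lambda> \<mu>)) else \<one>) =
      (if deg \<Lambda> \<alpha> \<le> n then res h (w 0 (n - deg \<Lambda> \<alpha>)) else \<one>))"
proof -
  have "range (\<lambda>n. if deg \<Lambda> \<mu> \<le> n then res g (z 0 (n - deg \<Lambda> \<mu>)) else \<one>) \<subseteq> carrier G"
    using assms by (auto simp: res_closed ipath_initial)
  then show ?thesis
    by (simp add: Q_shift_res assms tail_class_eq_iff)
qed

text \<open>
  The arrow given by \<open>(\<mu>, g, \<nu>)\<close> at \<open>\<kappa>y\<close> is also given by \<open>(\<mu>(g \<cdot> \<kappa>), g|\<^sub>\<kappa>, \<nu>\<kappa>)\<close> at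
  \<open>y\<close>.  This is how two representations of an arrow are compared, and how basic sets are shrunk.
\<close>

lemma germ_extend:
  assumes data: "ep_data \<mu> g \<nu> (concat_path \<Lambda> \<kappa> y)"
    and \<kappa>: "\<kappa> \<in> Mor \<Lambda>" and y: "y \<in> infinite_paths \<Lambda>" and sr: "src \<Lambda> \<kappa> = ip_rng y"
  shows "ep_data (cmp \<Lambda> \<mu> (act g \<kappa>)) (res g \<kappa>) (cmp \<Lambda> \<nu> \<kappa>) y"
    and "ep_germ (cmp \<Lambda> \<mu> (act g \<kappa>)) (res g \<kappa>) (cmp \<Lambda> \<nu> \<kappa>) y = ep_germ \<mu> g \<nu> (concat_path \<Lambda> \<kappa> y)"
proof -
  note d = ep_dataD[OF data]
  have g\<kappa>: "act g \<kappa> \<in> Mor \<Lambda>" "res g \<kappa> \<in> carrier G" "deg \<Lambda> (act g \<kappa>) = deg \<Lambda> \<kappa>"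
    using d \<kappa> by (simp_all add: act_closed res_closed deg_act)
  have rng: "ip_rng (concat_path \<Lambda> \<kappa> y) = rng \<Lambda> \<kappa>"
    by (rule ip_rng_concat_path[OF \<kappa> y sr])
  have \<nu>\<kappa>: "src \<Lambda> \<nu> = rng \<Lambda> \<kappa>"
    using d rng by simp
  have \<mu>\<kappa>: "src \<Lambda> \<mu> = rng \<Lambda> (act g \<kappa>)"
    using data rng \<kappa> by (simp add: ep_data_def rng_act)
  note act_y = act_concat_path[OF d(2) \<kappa> y sr]
  have gy: "act_ipath act res (res g \<kappa>) y \<in> infinite_paths \<Lambda>"
    by (rule act_ipath_closed[OF g\<kappa>(2) y])
  show "ep_data (cmp \<Lambda> \<mu> (act g \<kappa>)) (res g \<kappa>) (cmp \<Lambda> \<nu> \<kappa>) y"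
    using d \<kappa> y sr g\<kappa> \<nu>\<kappa> \<mu>\<kappa> act_y(1)
    by (simp add: ep_data_def cmp_closed src_cmp ip_rng_act_ipath)
  have "deg_int \<Lambda> (cmp \<Lambda> \<mu> (act g \<kappa>)) - deg_int \<Lambda> (cmp \<Lambda> \<nu> \<kappa>) = deg_int \<Lambda> \<mu> - deg_int \<Lambda> \<nu>"
    using d \<kappa> g\<kappa> \<nu>\<kappa> \<mu>\<kappa> by (auto simp: deg_int_def deg_cmp fun_eq_iff)
  moreover have "concat_path \<Lambda> (cmp \<Lambda> \<nu> \<kappa>) y = concat_path \<Lambda> \<nu> (concat_path \<Lambda> \<kappa> y)"
    using d \<kappa> y sr \<nu>\<kappa> by (simp add: concat_path_cmp)
  moreover have "concat_path \<Lambda> (cmp \<Lambda> \<mu> (act g \<kappa>)) (act_ipath act res (res g \<kappa>) y) =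
      concat_path \<Lambda> \<mu> (act_ipath act res g (concat_path \<Lambda> \<kappa> y))"
    using d g\<kappa> gy \<mu>\<kappa> act_y by (simp add: concat_path_cmp)
  moreover have "Q_shift G (deg_int \<Lambda> (cmp \<Lambda> \<mu> (act g \<kappa>))) (res_ipath G res (res g \<kappa>) y) =
      Q_shift G (deg_int \<Lambda> \<mu>) (res_ipath G res g (concat_path \<Lambda> \<kappa> y))"
  proof (subst Q_shift_res_eq_iff[OF g\<kappa>(2) y d(2) d(4)], intro exI[of _ "deg \<Lambda> \<mu> + deg \<Lambda> \<kappa>"] allI impI)
    fix n assume "deg \<Lambda> \<mu> + deg \<Lambda> \<kappa> \<le> n"
    then have n: "n = deg \<Lambda> \<mu> + deg \<Lambda> \<kappa> + (n - (deg \<Lambda> \<mu> + deg \<Lambda> \<kappa>))"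
      by (simp add: add_diff_degree)
    define p where "p = n - (deg \<Lambda> \<mu> + deg \<Lambda> \<kappa>)"
    have n: "n = deg \<Lambda> \<mu> + (deg \<Lambda> \<kappa> + p)"
      using n by (simp add: p_def add.assoc)
    have "res (res g \<kappa>) (y 0 p) = res g (concat_path \<Lambda> \<kappa> y 0 (deg \<Lambda> \<kappa> + p))"
      using concat_path_segment[OF \<kappa> y sr, of p] res_cmp[OF d(2) \<kappa>, of "y 0 p"] y sr
      by (simp add: ipath_initial)
    moreover have "n - (deg \<Lambda> \<mu> + deg \<Lambda> \<kappa>) = p" "n - deg \<Lambda> \<mu> = deg \<Lambda> \<kappa> + p"
      using n by (auto simp: fun_eq_iff)
    moreover have "deg \<Lambda> (cmp \<Lambda> \<mu> (act g \<kappa>)) = deg \<Lambda> \<mu> + deg \<Lambda> \<kappa>"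
      using d g\<kappa> \<mu>\<kappa> by (simp add: deg_cmp)
    ultimately show "(if deg \<Lambda> (cmp \<Lambda> \<mu> (act g \<kappa>)) \<le> n
          then res (res g \<kappa>) (y 0 (n - deg \<Lambda> (cmp \<Lambda> \<mu> (act g \<kappa>)))) else \<one>) =
        (if deg \<Lambda> \<mu> \<le> n then res g (concat_path \<Lambda> \<kappa> y 0 (n - deg \<Lambda> \<mu>)) else \<one>)"
      using n by simp
  qed
  ultimately show "ep_germ (cmp \<Lambda> \<mu> (act g \<kappa>)) (res g \<kappa>) (cmp \<Lambda> \<nu> \<kappa>) y = ep_germ \<mu> g \<nu> (concat_path \<Lambda> \<kappa> y)"
    by (simp add: ep_germ_def)
qed

text \<open>The special case in which \<open>\<kappa>\<close> is an initial segment of the source path.\<close>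

lemma germ_extend_along:
  assumes "ep_data \<mu> g \<nu> z"
  shows "ep_data (cmp \<Lambda> \<mu> (act g (z 0 m))) (res g (z 0 m)) (cmp \<Lambda> \<nu> (z 0 m)) (ip_shift m z)"
    and "ep_germ (cmp \<Lambda> \<mu> (act g (z 0 m))) (res g (z 0 m)) (cmp \<Lambda> \<nu> (z 0 m)) (ip_shift m z) =
      ep_germ \<mu> g \<nu> z"
proof -
  have "z \<in> infinite_paths \<Lambda>"
    using assms by (rule ep_dataD)
  then have "z 0 m \<in> Mor \<Lambda>" "ip_shift m z \<in> infinite_paths \<Lambda>" "src \<Lambda> (z 0 m) = ip_rng (ip_shift m z)"
    "concat_path \<Lambda> (z 0 m) (ip_shift m z) = z"
    by (simp_all add: ipath_initial ip_shift_closed ip_rng_shift concat_path_shift)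
  then show "ep_data (cmp \<Lambda> \<mu> (act g (z 0 m))) (res g (z 0 m)) (cmp \<Lambda> \<nu> (z 0 m)) (ip_shift m z)"
    "ep_germ (cmp \<Lambda> \<mu> (act g (z 0 m))) (res g (z 0 m)) (cmp \<Lambda> \<nu> (z 0 m)) (ip_shift m z) =
      ep_germ \<mu> g \<nu> z"
    using germ_extend[of \<mu> g \<nu> "z 0 m" "ip_shift m z"] assms by simp_all
qed

lemma ep_basic_extend_subset:
  assumes data: "ep_data \<mu> g \<nu> z"
  shows "ep_basic G \<Lambda> act res (cmp \<Lambda> \<mu> (act g (z 0 m))) (res g (z 0 m)) (cmp \<Lambda> \<nu> (z 0 m)) \<subseteq>
    ep_basic G \<Lambda> act res \<mu> g \<nu>"
proof
  note d = ep_dataD[OF data]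
  let ?\<kappa> = "z 0 m"
  note e = ep_dataD[OF germ_extend_along(1)[OF data, of m]]
  fix b assume "b \<in> ep_basic G \<Lambda> act res (cmp \<Lambda> \<mu> (act g ?\<kappa>)) (res g ?\<kappa>) (cmp \<Lambda> \<nu> ?\<kappa>)"
  then obtain y where y: "ep_data (cmp \<Lambda> \<mu> (act g ?\<kappa>)) (res g ?\<kappa>) (cmp \<Lambda> \<nu> ?\<kappa>) y"
    "b = ep_germ (cmp \<Lambda> \<mu> (act g ?\<kappa>)) (res g ?\<kappa>) (cmp \<Lambda> \<nu> ?\<kappa>) y"
    using ep_basic_eq[OF e(1-3)] by blast
  have \<kappa>: "?\<kappa> \<in> Mor \<Lambda>" "rng \<Lambda> ?\<kappa> = ip_rng z"
    using d by (simp_all add: ipath_initial)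
  have sr: "src \<Lambda> ?\<kappa> = ip_rng y"
    using ep_dataD(5)[OF y(1)] src_cmp[of \<nu> ?\<kappa>] \<kappa> d by simp
  have y': "y \<in> infinite_paths \<Lambda>"
    using y(1) by (rule ep_dataD)
  have data': "ep_data \<mu> g \<nu> (concat_path \<Lambda> ?\<kappa> y)"
    using data \<kappa> y' sr by (simp add: ep_data_def concat_path_closed ip_rng_concat_path)
  then show "b \<in> ep_basic G \<Lambda> act res \<mu> g \<nu>"
    using germ_extend(2)[OF data' \<kappa>(1) y' sr] y(2) ep_basic_eq[OF d(1-3)] by auto
qed

text \<open>
  If two arrows have the same ends and the same degree, then extensions of their representations
  whose right hand segments have equal degrees share both segments, because these are initial
  segments of the common source and of the common range.
\<close>

lemma germ_common_segments:
  assumes z: "ep_data \<mu> g \<nu> z" and w: "ep_data \<alpha> h \<beta> w"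
    and rng: "concat_path \<Lambda> \<mu> (act_ipath act res g z) = concat_path \<Lambda> \<alpha> (act_ipath act res h w)"
    and src: "concat_path \<Lambda> \<nu> z = concat_path \<Lambda> \<beta> w"
    and grading: "deg_int \<Lambda> \<mu> - deg_int \<Lambda> \<nu> = deg_int \<Lambda> \<alpha> - deg_int \<Lambda> \<beta>"
    and m: "deg \<Lambda> \<nu> + m = deg \<Lambda> \<beta> + m'"
  shows "deg \<Lambda> \<mu> + m = deg \<Lambda> \<alpha> + m'"
    and "cmp \<Lambda> \<nu> (z 0 m) = cmp \<Lambda> \<beta> (w 0 m')"
    and "cmp \<Lambda> \<mu> (act g (z 0 m)) = cmp \<Lambda> \<alpha> (act h (w 0 m'))"
proof -
  note dz = ep_dataD[OF z] and dw = ep_dataD[OF w]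
  show deg: "deg \<Lambda> \<mu> + m = deg \<Lambda> \<alpha> + m'"
  proof
    fix i
    have "deg \<Lambda> \<nu> i + m i = deg \<Lambda> \<beta> i + m' i"
      using fun_cong[OF m, of i] by simp
    moreover have "int (deg \<Lambda> \<mu> i) - int (deg \<Lambda> \<nu> i) = int (deg \<Lambda> \<alpha> i) - int (deg \<Lambda> \<beta> i)"
      using fun_cong[OF grading, of i] by (simp add: deg_int_def)
    ultimately show "(deg \<Lambda> \<mu> + m) i = (deg \<Lambda> \<alpha> + m') i"
      by simp
  qed
  show "cmp \<Lambda> \<nu> (z 0 m) = cmp \<Lambda> \<beta> (w 0 m')"
    using concat_path_segment[OF dz(3,4,5), of m] concat_path_segment[OF dw(3,4,5), of m'] src m
    by simp
  show "cmp \<Lambda> \<mu> (act g (z 0 m)) = cmp \<Lambda> \<alpha> (act h (w 0 m'))"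
    using concat_path_segment[OF dz(1,6,7), of m] concat_path_segment[OF dw(1,6,7), of m'] rng deg
    by (simp add: act_ipath_initial dz(2,4) dw(2,4))
qed

text \<open>
  Finite intersections and unions being harmless, the point is a basic set given by another
  representation of the same arrow.  Sufficiently long extensions of the two representations then
  coincide entirely: the outer segments by \<open>germ_common_segments\<close>, and the group elements because
  equality in \<open>Q\<^sub>k(G)\<close> is eventual equality.
\<close>

lemma germ_neighbourhood:
  assumes T: "openin (arrow_top EP) T" and z: "ep_data \<mu> g \<nu> z" and in_T: "ep_germ \<mu> g \<nu> z \<in> T"
  obtains N where "\<And>m. N \<le> m \<Longrightarrow>
    ep_basic G \<Lambda> act res (cmp \<Lambda> \<mu> (act g (z 0 m))) (res g (z 0 m)) (cmp \<Lambda> \<nu> (z 0 m)) \<subseteq> T"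
proof -
  let ?B = "\<lambda>m. ep_basic G \<Lambda> act res (cmp \<Lambda> \<mu> (act g (z 0 m))) (res g (z 0 m)) (cmp \<Lambda> \<nu> (z 0 m))"
  note dz = ep_dataD[OF z]
  have "generate_topology_on
      {ep_basic G \<Lambda> act res \<mu> g \<nu> | \<mu> g \<nu>. \<mu> \<in> Mor \<Lambda> \<and> g \<in> carrier G \<and> \<nu> \<in> Mor \<Lambda>} T"
    using T by (simp add: exel_pardo_groupoid_def openin_topology_generated_by_iff)
  then have "ep_germ \<mu> g \<nu> z \<in> T \<Longrightarrow> \<exists>N. \<forall>m. N \<le> m \<longrightarrow> ?B m \<subseteq> T"
  proof (induction rule: generate_topology_on.induct)
    case (Int a b)
    then obtain N N' where N: "\<forall>m. N \<le> m \<longrightarrow> ?B m \<subseteq> a" "\<forall>m. N' \<le> m \<longrightarrow> ?B m \<subseteq> b"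
      by blast
    have "?B m \<subseteq> a \<inter> b" if "N + N' \<le> m" for m
    proof -
      have "N \<le> m" "N' \<le> m"
        using that le_add_degree order_trans by metis+
      then show ?thesis
        using N by blast
    qed
    then show ?case by blast
  next
    case (Basis s)
    then obtain \<alpha> h \<beta> where s: "s = ep_basic G \<Lambda> act res \<alpha> h \<beta>" "\<alpha> \<in> Mor \<Lambda>" "h \<in> carrier G" "\<beta> \<in> Mor \<Lambda>"
      by blast
    then obtain w where w: "ep_data \<alpha> h \<beta> w" and eq: "ep_germ \<mu> g \<nu> z = ep_germ \<alpha> h \<beta> w"
      using Basis ep_basic_eq by auto
    note dw = ep_dataD[OF w]
    obtain N where N: "\<And>n. N \<le> n \<Longrightarrow>
        (if deg \<Lambda> \<mu> \<le> n then res g (z 0 (n - deg \<Lambda> \<mu>)) else \<one>) =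
        (if deg \<Lambda> \<alpha> \<le> n then res h (w 0 (n - deg \<Lambda> \<alpha>)) else \<one>)"
      using eq Q_shift_res_eq_iff[OF dz(2,4) dw(2,4), of \<mu> \<alpha>] unfolding ep_germ_def by blast
    have "?B m \<subseteq> s" if m: "N + deg \<Lambda> \<beta> \<le> m" for m
    proof -
      define m' where "m' = deg \<Lambda> \<nu> + m - deg \<Lambda> \<beta>"
      have m': "deg \<Lambda> \<nu> + m = deg \<Lambda> \<beta> + m'"
        unfolding m'_def using m by (metis add_diff_degree le_add_degree(2) order_trans)
      note common = germ_common_segments[OF z w _ _ _ m']
      have deg: "deg \<Lambda> \<mu> + m = deg \<Lambda> \<alpha> + m'"
        and \<nu>: "cmp \<Lambda> \<nu> (z 0 m) = cmp \<Lambda> \<beta> (w 0 m')"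
        and \<mu>: "cmp \<Lambda> \<mu> (act g (z 0 m)) = cmp \<Lambda> \<alpha> (act h (w 0 m'))"
        using common eq unfolding ep_germ_def by blast+
      have "N \<le> deg \<Lambda> \<mu> + m"
        using m by (metis le_add_degree order_trans)
      moreover have "deg \<Lambda> \<mu> + m - deg \<Lambda> \<mu> = m" "deg \<Lambda> \<mu> + m - deg \<Lambda> \<alpha> = m'"
        using deg by (simp_all add: fun_eq_iff)
      moreover have "deg \<Lambda> \<alpha> \<le> deg \<Lambda> \<mu> + m"
        by (simp add: deg)
      ultimately have "res g (z 0 m) = res h (w 0 m')"
        using N[of "deg \<Lambda> \<mu> + m"] by simp
      then have "?B m = ep_basic G \<Lambda> act res (cmp \<Lambda> \<alpha> (act h (w 0 m'))) (res h (w 0 m')) (cmp \<Lambda> \<beta> (w 0 m'))"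
        using \<nu> \<mu> by simp
      then show ?thesis
        using ep_basic_extend_subset[OF w, of m'] s by simp
    qed
    then show ?case by blast
  qed blast+
  then show ?thesis
    using that in_T by blast
qed


section \<open>Orbit closures\<close>

lemma ep_orbit_iff:
  "y \<in> gpd_orbit EP x \<longleftrightarrow>
    (\<exists>\<mu> g \<nu> z. ep_data \<mu> g \<nu> z \<and> x = concat_path \<Lambda> \<nu> z \<and> y = concat_path \<Lambda> \<mu> (act_ipath act res g z))"
  unfolding gpd_orbit_def using arrows_iff germ_ends by (smt (verit, best) mem_Collect_eq)

text \<open>
  The vertices of a path in the orbit of \<open>x\<close> are eventually translates of those of \<open>x\<close>, so all of
  them lie in the tail of \<open>x\<close>, and this property passes to the closure.  Conversely, if all
  vertices of \<open>y\<close> lie in the tail, every initial segment of \<open>y\<close> can be continued by a path ending at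
  some \<open>g \<cdot> x(m)\<close>, and then by the translate of the rest of \<open>x\<close>.
\<close>

lemma orbit_closure:
  assumes x: "x \<in> infinite_paths \<Lambda>"
  shows "path_space \<Lambda> closure_of gpd_orbit EP x = {y \<in> infinite_paths \<Lambda>. \<forall>n. y n n \<in> tail_of x}"
proof (rule equalityI; rule subsetI)
  fix y assume y: "y \<in> path_space \<Lambda> closure_of gpd_orbit EP x"
  then have y_path: "y \<in> infinite_paths \<Lambda>"
    using topspace_path_space by (auto simp: in_closure_of)
  have "y n n \<in> tail_of x" for n
  proof -
    have "openin (path_space \<Lambda>) (cylinder \<Lambda> (y 0 n))"
      unfolding path_space_def using y_path
      by (intro topology_generated_by_Basis imageI) (simp add: ipath_initial)
    moreover have "y \<in> cylinder \<Lambda> (y 0 n)"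
      using y_path by (simp add: cylinder_eq ipath_initial)
    ultimately obtain w where w: "w \<in> gpd_orbit EP x" "w \<in> cylinder \<Lambda> (y 0 n)"
      using y unfolding in_closure_of by blast
    then obtain \<mu> g \<nu> z where data: "ep_data \<mu> g \<nu> z" and xz: "x = concat_path \<Lambda> \<nu> z"
      and wz: "w = concat_path \<Lambda> \<mu> (act_ipath act res g z)"
      by (auto simp: ep_orbit_iff)
    note d = ep_dataD[OF data]
    have w': "w \<in> infinite_paths \<Lambda>" "w 0 n = y 0 n"
      using w(2) y_path by (auto simp: cylinder_eq ipath_initial)
    have "w (deg \<Lambda> \<mu> + n) (deg \<Lambda> \<mu> + n) = act (res g (z 0 n)) (z n n)"
      using concat_path_vertex[OF d(1,6,7), of n] by (simp add: wz act_ipath_segment)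
    also have "z n n = x (deg \<Lambda> \<nu> + n) (deg \<Lambda> \<nu> + n)"
      using concat_path_vertex[OF d(3-5), of n] by (simp add: xz)
    finally have "reaches (w n n) (act (res g (z 0 n)) (x (deg \<Lambda> \<nu> + n) (deg \<Lambda> \<nu> + n)))"
      using reaches_ipath[OF w'(1), of n "deg \<Lambda> \<mu> + n"] le_add_degree(2) by metis
    moreover have "w n n = y n n"
      using ipath_initial(4)[OF w'(1), of n] ipath_initial(4)[OF y_path, of n] w'(2) by simp
    moreover have "res g (z 0 n) \<in> carrier G"
      using d by (simp add: res_closed ipath_initial)
    ultimately show ?thesis
      using ipath_vertex[OF y_path] unfolding tail_of_def by auto
  qed
  then show "y \<in> {y \<in> infinite_paths \<Lambda>. \<forall>n. y n n \<in> tail_of x}"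
    using y_path by simp
next
  fix y assume y: "y \<in> {y \<in> infinite_paths \<Lambda>. \<forall>n. y n n \<in> tail_of x}"
  then have y_path: "y \<in> infinite_paths \<Lambda>" by simp
  show "y \<in> path_space \<Lambda> closure_of gpd_orbit EP x"
    unfolding in_closure_of topspace_path_space
  proof (intro conjI allI impI)
    fix T assume "y \<in> T \<and> openin (path_space \<Lambda>) T"
    then obtain N where N: "\<And>m. N \<le> m \<Longrightarrow> cylinder \<Lambda> (y 0 m) \<subseteq> T"
      using cylinder_neighbourhood by blast
    obtain m g \<kappa> where g: "g \<in> carrier G"
      and \<kappa>: "\<kappa> \<in> Mor \<Lambda>" "rng \<Lambda> \<kappa> = y N N" "src \<Lambda> \<kappa> = act g (x m m)"
    proof -
      have "y N N \<in> tail_of x"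
        using y by simp
      then show ?thesis
        using that unfolding tail_of_def reaches_iff by blast
    qed
    let ?z = "ip_shift m x" and ?\<mu> = "cmp \<Lambda> (y 0 N) \<kappa>"
    have data: "ep_data ?\<mu> g (x 0 m) ?z"
      using g \<kappa> x y_path
      by (simp add: ep_data_def ipath_initial cmp_closed src_cmp ip_shift_closed ip_rng_shift)
    note d = ep_dataD[OF data]
    let ?w = "concat_path \<Lambda> ?\<mu> (act_ipath act res g ?z)"
    have "?w \<in> gpd_orbit EP x"
      unfolding ep_orbit_iff using data concat_path_shift[OF x, of m] by metis
    moreover have "?w \<in> cylinder \<Lambda> (y 0 N)"
    proof -
      have sr: "src \<Lambda> \<kappa> = ip_rng (act_ipath act res g ?z)" "src \<Lambda> (y 0 N) = rng \<Lambda> \<kappa>"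
        using d(7) \<kappa> y_path by (simp_all add: src_cmp ipath_initial)
      then have "?w = concat_path \<Lambda> (y 0 N) (concat_path \<Lambda> \<kappa> (act_ipath act res g ?z))"
        using \<kappa> d y_path by (simp add: concat_path_cmp ipath_initial)
      moreover have "concat_path \<Lambda> \<kappa> (act_ipath act res g ?z) \<in> infinite_paths \<Lambda>"
        "src \<Lambda> (y 0 N) = ip_rng (concat_path \<Lambda> \<kappa> (act_ipath act res g ?z))"
        using \<kappa>(1) d(6) sr by (simp_all add: concat_path_closed ip_rng_concat_path)
      ultimately show ?thesis
        unfolding cylinder_def by blast
    qed
    ultimately show "\<exists>w. w \<in> gpd_orbit EP x \<and> w \<in> T"
      using N[of N] by blast
  qed (use y_path in simp)
qed

end


section \<open>Isotropy over an orbit closure\<close>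

context self_similar_k_graph
begin

lemma maximal_tail_hereditary:
  "\<lbrakk>M \<in> maximal_tails G \<Lambda> act; v \<in> vertices \<Lambda>; w \<in> M; reaches v w\<rbrakk> \<Longrightarrow> v \<in> M"
  unfolding maximal_tails_iff by blast

lemma concat_path_in_tail:
  assumes M: "M \<in> maximal_tails G \<Lambda> act"
    and \<mu>: "\<mu> \<in> Mor \<Lambda>" and y: "y \<in> infinite_paths \<Lambda>" "src \<Lambda> \<mu> = ip_rng y" "\<And>n. y n n \<in> M"
  shows "concat_path \<Lambda> \<mu> y n n \<in> M"
proof -
  let ?w = "concat_path \<Lambda> \<mu> y"
  have w: "?w \<in> infinite_paths \<Lambda>"
    by (rule concat_path_closed[OF \<mu> y(1,2)])
  have "reaches (?w n n) (y n n)"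
    using reaches_ipath[OF w, of n "deg \<Lambda> \<mu> + n"] concat_path_vertex[OF \<mu> y(1,2), of n]
      le_add_degree(2) by metis
  then show ?thesis
    using maximal_tail_hereditary[OF M ipath_vertex[OF w] y(3)] by blast
qed

lemma act_in_tail_iff:
  assumes M: "M \<in> maximal_tails G \<Lambda> act" and g: "g \<in> carrier G" and v: "v \<in> vertices \<Lambda>"
  shows "act g v \<in> M \<longleftrightarrow> v \<in> M"
proof
  assume "act g v \<in> M"
  then have "act (inv g) (act g v) \<in> M"
    using M g unfolding maximal_tails_iff by simp
  moreover have "act (inv g) (act g v) = v"
    using composition_rule[of v "inv g" g] act_one[of v] g v by (simp add: vertices_def)
  ultimately show "v \<in> M" by simp
qed (use M g in \<open>simp add: maximal_tails_iff\<close>)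

lemma concat_path_vertex_left:
  assumes "v \<in> vertices \<Lambda>" "z \<in> infinite_paths \<Lambda>" "ip_rng z = v"
  shows "concat_path \<Lambda> v z = z"
proof -
  have "ip_shift 0 z = z"
    by (simp add: ip_shift_def)
  then show ?thesis
    using concat_path_shift[OF assms(2), of 0] assms(3) by (simp add: ip_rng_def)
qed

lemma essentially_central_EP_iff:
  "essentially_central_isotropy EP standard_grading \<longleftrightarrow>
    (\<forall>x \<in> infinite_paths \<Lambda>. inj_on standard_grading
      {a \<in> iso_interior EP {y \<in> infinite_paths \<Lambda>. \<forall>n. y n n \<in> tail_of x}. gpd_src EP a = x})"
proof -
  have "c + b = b + c" for b c :: "'k \<Rightarrow> int"
    by (rule add.commute)
  then have "{c :: 'k \<Rightarrow> int. \<forall>b. c + b = b + c} = UNIV"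
    by blast
  then show ?thesis
    unfolding essentially_central_isotropy_def Let_def unit_top_EP topspace_path_space
    by (intro ball_cong refl) (simp only: orbit_closure subset_UNIV simp_thms)
qed

text \<open>
  If \<open>h\<close> acts trivially on \<open>v\<Lambda>M\<close>, then it fixes every path from \<open>v\<close> that runs inside the tail.  So
  the basic set given by \<open>(v, h, v)\<close> consists of isotropy over the closed invariant set of paths
  inside \<open>M\<close>.
\<close>

lemma trivial_action_iso_interior:
  assumes M: "M \<in> maximal_tails G \<Lambda> act" and v: "v \<in> M" and h: "h \<in> carrier G"
    and trivial: "\<And>\<mu>. \<mu> \<in> paths_into \<Lambda> v M \<Longrightarrow> act h \<mu> = \<mu>"
    and x: "x \<in> infinite_paths \<Lambda>" "ip_rng x = v" "\<And>n. x n n \<in> M"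
  shows "ep_germ v h v x \<in> iso_interior EP {y \<in> infinite_paths \<Lambda>. \<forall>n. y n n \<in> M}"
proof -
  have v': "v \<in> vertices \<Lambda>"
    using M v by (auto simp: maximal_tails_iff)
  note v'' = vertex_rng_src[OF v']
  have hv: "act h v = v"
    using trivial[of v] v v'' by (simp add: paths_into_def)
  have fixed: "act_ipath act res h z = z" if z: "z \<in> infinite_paths \<Lambda>" "ip_rng z = v" "\<And>n. z n n \<in> M" for z
  proof (rule ipath_eqI[of _ _ 0])
    fix n
    have "z 0 (0 + n) \<in> paths_into \<Lambda> v M"
      unfolding paths_into_def using z by (simp add: ipath_initial)
    then show "act_ipath act res h z 0 (0 + n) = z 0 (0 + n)"
      using trivial h z by (simp add: act_ipath_initial)
  qed (use h z act_ipath_closed in auto)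
  have data: "ep_data v h v z \<longleftrightarrow> z \<in> infinite_paths \<Lambda> \<and> ip_rng z = v" for z
    using v'' h hv by (auto simp: ep_data_def)
  have ends: "gpd_rng EP (ep_germ v h v z) = act_ipath act res h z"
    "gpd_src EP (ep_germ v h v z) = z" if "z \<in> infinite_paths \<Lambda>" "ip_rng z = v" for z
    using that v' h hv by (simp_all add: concat_path_vertex_left act_ipath_closed ip_rng_act_ipath)
  show ?thesis
    unfolding iso_interior_iff
  proof (intro exI[of _ "ep_basic G \<Lambda> act res v h v"] conjI ballI impI)
    show "openin (arrow_top EP) (ep_basic G \<Lambda> act res v h v)"
      by (rule ep_basic_open) (use v'' h in auto)
    show "ep_germ v h v x \<in> ep_basic G \<Lambda> act res v h v"
      using ep_basic_eq[of v h v] v'' h data x by auto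
    show "gpd_rng EP (ep_germ v h v x) \<in> {y \<in> infinite_paths \<Lambda>. \<forall>n. y n n \<in> M}"
      using ends[OF x(1,2)] fixed[OF x] x by simp
  next
    fix b assume "b \<in> ep_basic G \<Lambda> act res v h v"
      and b_M: "gpd_rng EP b \<in> {y \<in> infinite_paths \<Lambda>. \<forall>n. y n n \<in> M}"
    then obtain z where z: "z \<in> infinite_paths \<Lambda>" "ip_rng z = v" and b: "b = ep_germ v h v z"
      using ep_basic_eq[of v h v] v'' h data by auto
    have "z n n \<in> M" for n
    proof -
      have "act (res h (z 0 n)) (z n n) \<in> M"
        using b_M ends[OF z] b by (auto simp: act_ipath_segment dest: spec[of _ n])
      then show ?thesis
        using act_in_tail_iff[OF M, of "res h (z 0 n)" "z n n"] h z
        by (simp add: res_closed ipath_initial ipath_vertex)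
    qed
    then show "gpd_rng EP b = gpd_src EP b"
      using ends[OF z] b fixed z by simp
  qed
qed

text \<open>
  Pseudo-freeness turns the equality of the arrows given by \<open>(v, g, v)\<close> and \<open>(v, 1, v)\<close> at a path
  that \<open>g\<close> fixes into \<open>g = 1\<close>: equality in \<open>Q\<^sub>k(G)\<close> means that \<open>g\<close> restricts to \<open>1\<close> along some
  initial segment.
\<close>

lemma germ_eq_unit:
  assumes pseudo_free: "pseudo_free G \<Lambda> act res" and v: "v \<in> vertices \<Lambda>" and g: "g \<in> carrier G"
    and x: "x \<in> infinite_paths \<Lambda>" "\<And>n. act g (x 0 n) = x 0 n"
    and eq: "ep_germ v g v x = ep_germ v \<one> v x"
  shows "g = \<one>"
proof -
  have "deg \<Lambda> v = 0"
    using v by (simp add: vertices_def)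
  moreover have "Q_shift G (deg_int \<Lambda> v) (res_ipath G res g x) =
      Q_shift G (deg_int \<Lambda> v) (res_ipath G res \<one> x)"
    using eq unfolding ep_germ_def prod.inject by (elim conjE)
  ultimately obtain N where "\<forall>n. N \<le> n \<longrightarrow> res g (x 0 (n - 0)) = res \<one> (x 0 (n - 0))"
    unfolding Q_shift_res_eq_iff[OF g x(1) G.one_closed x(1)] by auto
  then have N: "res g (x 0 (N - 0)) = \<one>"
    using x(1) by (simp add: res_one ipath_initial)
  show ?thesis
    using pseudo_free g ipath_initial(1)[OF x(1), of "N - 0"] x(2)[of "N - 0"] N
    unfolding pseudo_free_def by metis
qed

text \<open>
  Two arrows of equal degree in the interior of the isotropy at \<open>x\<close> extend to \<open>(\<mu>, g, \<nu>)\<close> and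
  \<open>(\<mu>, h, \<nu>)\<close> with common outer segments, so that both basic sets consist of isotropy over the
  orbit closure.  Then \<open>\<mu>(g \<cdot> z) = \<nu>z = \<mu>(h \<cdot> z)\<close> for all \<open>z\<close> inside the tail, and since every path
  in \<open>s(\<nu>)\<Lambda>M\<close> is an initial segment of such a \<open>z\<close>, the element \<open>inv h \<otimes> g\<close> acts trivially on
  \<open>s(\<nu>)\<Lambda>M\<close>.
\<close>

lemma iso_interior_inj:
  assumes countable: "countable (Mor \<Lambda>)" and x: "x \<in> infinite_paths \<Lambda>"
    and M_def: "M = tail_of x"
    and no_trivial: "\<And>v g. \<lbrakk>v \<in> M; g \<in> carrier G; \<And>\<mu>. \<mu> \<in> paths_into \<Lambda> v M \<Longrightarrow> act g \<mu> = \<mu>\<rbrakk> \<Longrightarrow> g = \<one>"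
  shows "inj_on standard_grading
    {a \<in> iso_interior EP {y \<in> infinite_paths \<Lambda>. \<forall>n. y n n \<in> M}. gpd_src EP a = x}"
proof (rule inj_onI)
  let ?F = "{y \<in> infinite_paths \<Lambda>. \<forall>n. y n n \<in> M}"
  have M: "M \<in> maximal_tails G \<Lambda> act"
    unfolding M_def by (rule tail_of_maximal[OF x])
  have x_M: "x n n \<in> M" for n
    unfolding M_def by (rule vertex_in_tail_of[OF x])
  fix a b
  assume a: "a \<in> {a \<in> iso_interior EP ?F. gpd_src EP a = x}"
    and b: "b \<in> {a \<in> iso_interior EP ?F. gpd_src EP a = x}"
    and grading: "standard_grading a = standard_grading b"
  obtain T where T: "openin (arrow_top EP) T" "a \<in> T" "gpd_rng EP a \<in> ?F"
      "\<And>c. \<lbrakk>c \<in> T; gpd_rng EP c \<in> ?F\<rbrakk> \<Longrightarrow> gpd_rng EP c = gpd_src EP c"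
    using a unfolding iso_interior_iff by blast
  obtain U where U: "openin (arrow_top EP) U" "b \<in> U" "gpd_rng EP b \<in> ?F"
      "\<And>c. \<lbrakk>c \<in> U; gpd_rng EP c \<in> ?F\<rbrakk> \<Longrightarrow> gpd_rng EP c = gpd_src EP c"
    using b unfolding iso_interior_iff by blast
  obtain \<mu> g \<nu> z where z: "ep_data \<mu> g \<nu> z" and az: "a = ep_germ \<mu> g \<nu> z"
    using openin_subset[OF T(1)] T(2) arrows_iff by blast
  obtain \<alpha> h \<beta> w where w: "ep_data \<alpha> h \<beta> w" and bw: "b = ep_germ \<alpha> h \<beta> w"
    using openin_subset[OF U(1)] U(2) arrows_iff by blast
  obtain N where N: "\<And>m. N \<le> m \<Longrightarrow>
      ep_basic G \<Lambda> act res (cmp \<Lambda> \<mu> (act g (z 0 m))) (res g (z 0 m)) (cmp \<Lambda> \<nu> (z 0 m)) \<subseteq> T"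
    using germ_neighbourhood[OF T(1) z] T(2) az by blast
  obtain N' where N': "\<And>m. N' \<le> m \<Longrightarrow>
      ep_basic G \<Lambda> act res (cmp \<Lambda> \<alpha> (act h (w 0 m))) (res h (w 0 m)) (cmp \<Lambda> \<beta> (w 0 m)) \<subseteq> U"
    using germ_neighbourhood[OF U(1) w] U(2) bw by blast
  \<comment> \<open>Both lengths pass their thresholds, and the two right hand segments become equally long.\<close>
  define m where "m = N + N' + deg \<Lambda> \<beta>"
  define m' where "m' = N + N' + deg \<Lambda> \<nu>"
  have ends_a: "concat_path \<Lambda> \<mu> (act_ipath act res g z) = x" "concat_path \<Lambda> \<nu> z = x"
    using a T(4)[OF T(2,3)] az by simp_all
  have ends_b: "concat_path \<Lambda> \<alpha> (act_ipath act res h w) = x" "concat_path \<Lambda> \<beta> w = x"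
    using b U(4)[OF U(2,3)] bw by simp_all
  have mm': "deg \<Lambda> \<nu> + m = deg \<Lambda> \<beta> + m'"
    by (simp add: m_def m'_def ac_simps)
  have degs: "deg_int \<Lambda> \<mu> - deg_int \<Lambda> \<nu> = deg_int \<Lambda> \<alpha> - deg_int \<Lambda> \<beta>"
    using grading az bw by simp
  note common = germ_common_segments[OF z w ends_a(1)[folded ends_b(1)] ends_a(2)[folded ends_b(2)] degs mm']
  define \<mu>' \<nu>' g' h' where "\<mu>' = cmp \<Lambda> \<mu> (act g (z 0 m))" and "\<nu>' = cmp \<Lambda> \<nu> (z 0 m)"
    and "g' = res g (z 0 m)" and "h' = res h (w 0 m')"
  have g': "ep_data \<mu>' g' \<nu>' (ip_shift m z)" "ep_germ \<mu>' g' \<nu>' (ip_shift m z) = a"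
    using germ_extend_along[OF z, of m] az by (simp_all add: \<mu>'_def \<nu>'_def g'_def)
  have h': "ep_data \<mu>' h' \<nu>' (ip_shift m' w)" "ep_germ \<mu>' h' \<nu>' (ip_shift m' w) = b"
    using germ_extend_along[OF w, of m'] bw common by (simp_all add: \<mu>'_def \<nu>'_def h'_def)
  note dg = ep_dataD[OF g'(1)] and dh = ep_dataD[OF h'(1)]
  have shift_eq: "ip_shift m z = ip_shift m' w"
  proof -
    have "concat_path \<Lambda> \<nu>' (ip_shift m z) = concat_path \<Lambda> \<nu>' (ip_shift m' w)"
      using a b germ_ends(2)[of \<mu>' g' \<nu>' "ip_shift m z"] germ_ends(2)[of \<mu>' h' \<nu>' "ip_shift m' w"]
      by (simp add: g'(2) h'(2))
    from arg_cong[OF this, of "ip_shift (deg \<Lambda> \<nu>')"] show ?thesis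
      by (simp only: shift_concat_path[OF dg(3-5)] shift_concat_path[OF dh(3-5)])
  qed
  define v where "v = src \<Lambda> \<nu>'"
  have v: "v = ip_rng (ip_shift m z)"
    using dg(5) by (simp add: v_def)
  have v_M: "v \<in> M"
  proof -
    have "v = z m m"
      by (simp add: v ip_rng_shift)
    also have "\<dots> = x (deg \<Lambda> \<nu> + m) (deg \<Lambda> \<nu> + m)"
      using concat_path_vertex[OF ep_dataD(3-5)[OF z], of m] ends_a(2) by simp
    finally show ?thesis
      using x_M by simp
  qed
  have same_action: "act g' \<kappa> = act h' \<kappa>" if \<kappa>_in: "\<kappa> \<in> paths_into \<Lambda> v M" for \<kappa>
  proof -
    have \<kappa>: "\<kappa> \<in> Mor \<Lambda>" "rng \<Lambda> \<kappa> = v" "src \<Lambda> \<kappa> \<in> M"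
      using \<kappa>_in by (auto simp: paths_into_def)
    obtain y where y: "y \<in> infinite_paths \<Lambda>" "y 0 (deg \<Lambda> \<kappa>) = \<kappa>" "tail_of y = M"
      using maximal_tail_eq_tail_of[OF countable M \<kappa>(1,3)] .
    have y_M: "y n n \<in> M" for n
      using vertex_in_tail_of[OF y(1)] y(3) by blast
    have y_v: "ip_rng y = v"
      using ipath_initial(3)[OF y(1), of "deg \<Lambda> \<kappa>"] y(2) \<kappa>(2) by simp
    have fixes_tail: "concat_path \<Lambda> \<mu>' (act_ipath act res k y) = concat_path \<Lambda> \<nu>' y"
      "src \<Lambda> \<mu>' = ip_rng (act_ipath act res k y)"
      if k: "ep_data \<mu>' k \<nu>' (ip_shift m z)"
        and V: "ep_basic G \<Lambda> act res \<mu>' k \<nu>' \<subseteq> V"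
          "\<And>c. \<lbrakk>c \<in> V; gpd_rng EP c \<in> ?F\<rbrakk> \<Longrightarrow> gpd_rng EP c = gpd_src EP c" for k V
    proof -
      note dk = ep_dataD[OF k]
      have data: "ep_data \<mu>' k \<nu>' y"
        using k y(1) y_v v by (simp add: ep_data_def)
      note dy = ep_dataD[OF data]
      show "src \<Lambda> \<mu>' = ip_rng (act_ipath act res k y)"
        by (rule dy)
      have "ep_germ \<mu>' k \<nu>' y \<in> V"
        using V(1) ep_basic_eq[OF dk(1-3)] data by blast
      moreover have "act_ipath act res k y n n \<in> M" for n
        using M y_M dk(2) y(1) by (simp add: act_ipath_segment maximal_tails_iff res_closed ipath_initial)
      then have "gpd_rng EP (ep_germ \<mu>' k \<nu>' y) \<in> ?F"
        using concat_path_in_tail[OF M dy(1,6,7)] concat_path_closed[OF dy(1,6,7)] by simp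
      ultimately show "concat_path \<Lambda> \<mu>' (act_ipath act res k y) = concat_path \<Lambda> \<nu>' y"
        using V(2)[of "ep_germ \<mu>' k \<nu>' y"] by simp
    qed
    have "N \<le> m" "N' \<le> m'"
      by (simp_all add: m_def m'_def le_fun_def)
    then have "ep_basic G \<Lambda> act res \<mu>' g' \<nu>' \<subseteq> T" "ep_basic G \<Lambda> act res \<mu>' h' \<nu>' \<subseteq> U"
      using N[of m] N'[of m'] common by (simp_all add: \<mu>'_def \<nu>'_def g'_def h'_def)
    note fg = fixes_tail[OF g'(1) this(1) T(4)] and fh = fixes_tail[OF h'(1)[folded shift_eq] this(2) U(4)]
    have paths: "act_ipath act res g' y \<in> infinite_paths \<Lambda>" "act_ipath act res h' y \<in> infinite_paths \<Lambda>"
      using act_ipath_closed dg(2) dh(2) y(1) by blast+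
    have "concat_path \<Lambda> \<mu>' (act_ipath act res g' y) = concat_path \<Lambda> \<mu>' (act_ipath act res h' y)"
      by (simp only: fg(1) fh(1))
    from arg_cong[OF this, of "ip_shift (deg \<Lambda> \<mu>')"]
    have "act_ipath act res g' y = act_ipath act res h' y"
      by (simp only: shift_concat_path[OF dg(1) paths(1) fg(2)] shift_concat_path[OF dg(1) paths(2) fh(2)])
    then have "act_ipath act res g' y 0 (deg \<Lambda> \<kappa>) = act_ipath act res h' y 0 (deg \<Lambda> \<kappa>)"
      by simp
    then show ?thesis
      by (simp only: act_ipath_initial[OF dg(2) y(1)] act_ipath_initial[OF dh(2) y(1)] y(2))
  qed
  have "inv h' \<otimes> g' = \<one>"
  proof (rule no_trivial[OF v_M])
    show "inv h' \<otimes> g' \<in> carrier G"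
      using dg(2) dh(2) by simp
    fix \<kappa> assume \<kappa>: "\<kappa> \<in> paths_into \<Lambda> v M"
    then have \<kappa>': "\<kappa> \<in> Mor \<Lambda>"
      by (simp add: paths_into_def)
    have "act (inv h' \<otimes> g') \<kappa> = act (inv h') (act h' \<kappa>)"
      using composition_rule[OF \<kappa>' G.inv_closed[OF dh(2)] dg(2)] same_action[OF \<kappa>] by simp
    also have "\<dots> = act (inv h' \<otimes> h') \<kappa>"
      using composition_rule[OF \<kappa>' G.inv_closed[OF dh(2)] dh(2)] by simp
    also have "\<dots> = \<kappa>"
      using act_one[OF \<kappa>'] G.l_inv[OF dh(2)] by simp
    finally show "act (inv h' \<otimes> g') \<kappa> = \<kappa>" .
  qed
  moreover have "h' \<otimes> (inv h' \<otimes> g') = g'"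
    using dg(2) dh(2) by (simp add: G.m_assoc[symmetric])
  ultimately have "g' = h'"
    using G.r_one[OF dh(2)] by simp
  then show "a = b"
    using g'(2) h'(2) shift_eq by simp
qed

end

theorem proposition5p11:
  fixes G :: "('g, 'm) monoid_scheme"
    and \<Lambda> :: "('l, 'k::finite) kgraph"
    and act :: "'g \<Rightarrow> 'l \<Rightarrow> 'l"
    and res :: "'g \<Rightarrow> 'l \<Rightarrow> 'g"
  assumes "self_similar_k_graph G \<Lambda> act res"
    and "countable (carrier G)"
    and "countable (Mor \<Lambda>)"
    and "pseudo_free G \<Lambda> act res"
    and "row_finite_without_sources \<Lambda>"
  shows "essentially_central_isotropy (exel_pardo_groupoid G \<Lambda> act res) standard_grading
    \<longleftrightarrow> (\<forall>M \<in> maximal_tails G \<Lambda> act. \<forall>v \<in> M.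
          \<not> (\<exists>g \<in> carrier G. g \<noteq> \<one>\<^bsub>G\<^esub> \<and> (\<forall>\<mu> \<in> paths_into \<Lambda> v M. act g \<mu> = \<mu>)))"
    (is "?central \<longleftrightarrow> ?faithful")
proof -
  interpret self_similar_k_graph G \<Lambda> act res
    by (rule assms(1))
  show ?thesis
  proof
    assume central: ?central
    have "g = \<one>\<^bsub>G\<^esub>" if M: "M \<in> maximal_tails G \<Lambda> act" and v: "v \<in> M" and g: "g \<in> carrier G"
      and trivial: "\<And>\<mu>. \<mu> \<in> paths_into \<Lambda> v M \<Longrightarrow> act g \<mu> = \<mu>" for M v g
    proof -
      have v': "v \<in> vertices \<Lambda>"
        using M v by (auto simp: maximal_tails_iff)
      note v'' = vertex_rng_src[OF v']
      obtain x where x: "x \<in> infinite_paths \<Lambda>" "x 0 (deg \<Lambda> v) = v" "tail_of x = M"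
        using maximal_tail_eq_tail_of[OF assms(3) M, of v] v v'' by auto
      have x_v: "ip_rng x = v"
        using x(2) v'' by (simp add: ip_rng_def)
      have x_M: "x n n \<in> M" for n
        using vertex_in_tail_of[OF x(1)] x(3) by blast
      let ?I = "{a \<in> iso_interior EP {y \<in> infinite_paths \<Lambda>. \<forall>n. y n n \<in> M}. gpd_src EP a = x}"
      have inj: "inj_on standard_grading ?I"
        using central x(1,3) unfolding essentially_central_EP_iff by blast
      have "act \<one>\<^bsub>G\<^esub> \<mu> = \<mu>" if "\<mu> \<in> paths_into \<Lambda> v M" for \<mu>
        using that by (simp add: paths_into_def act_one)
      then have "ep_germ v \<one>\<^bsub>G\<^esub> v x \<in> ?I" "ep_germ v g v x \<in> ?I"
        using trivial_action_iso_interior[OF M v _ _ x(1) x_v x_M] g trivial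
        by (simp_all add: concat_path_vertex_left v' x(1) x_v)
      then have "ep_germ v g v x = ep_germ v \<one>\<^bsub>G\<^esub> v x"
        by (intro inj_onD[OF inj]) simp_all
      moreover have "act g (x 0 n) = x 0 n" for n
        by (rule trivial) (use x(1) x_v x_M in \<open>simp add: paths_into_def ipath_initial\<close>)
      ultimately show "g = \<one>\<^bsub>G\<^esub>"
        using germ_eq_unit[OF assms(4) v' g x(1)] by blast
    qed
    then show ?faithful by blast
  next
    assume faithful: ?faithful
    show ?central
      unfolding essentially_central_EP_iff
    proof
      fix x assume x: "x \<in> infinite_paths \<Lambda>"
      show "inj_on standard_grading
          {a \<in> iso_interior EP {y \<in> infinite_paths \<Lambda>. \<forall>n. y n n \<in> tail_of x}. gpd_src EP a = x}"
      proof (rule iso_interior_inj[OF assms(3) x refl])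
        fix v g assume "v \<in> tail_of x" "g \<in> carrier G" "\<And>\<mu>. \<mu> \<in> paths_into \<Lambda> v (tail_of x) \<Longrightarrow> act g \<mu> = \<mu>"
        then show "g = \<one>\<^bsub>G\<^esub>"
          using bspec[OF bspec[OF faithful tail_of_maximal[OF x]]] by blast
      qed
    qed
  qed
qed

end
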